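(* Let $s$ and $n$ be positive integers, and let $x^{(k)}_i$ ($1\le k\le s$, $1\le i\le n$) be $sn$ independent variables. Then $$\det\Big(\mathbf{GL}_n(\lambda;X_\mu)\Big)_{\lambda\subset((s-1)^n),\ \mu\in Z_{s,n}}=\prod_{1\le k<l\le s}\ \prod_{i,j=1}^n\left(x^{(k)}_i-x^{(l)}_j\right)^{\binom{s+n-i-j-1}{s-2}},$$ and $$\det\Big(\mathbf{O}_{2n+1}(\lambda;X_\mu)\Big)_{\lambda\subset((s-1)^n),\ \mu\in Z_{s,n}}=\det\Big(\mathbf{Sp}_{2n}(\lambda;X_\mu)\Big)_{\lambda\subset((s-1)^n),\ \mu\in Z_{s,n}}=\det\Big(\mathbf{O}_{2n}(\lambda;X_\mu)\Big)_{\lambda\subset((s-1)^n),\ \mu\in Z_{s,n}}$$ $$=\prod_{1\le k<l\le s}\ \prod_{i,j=1}^{n}\left\{\frac{(x^{(l)}_j-x^{(k)}_i)(1-x^{(k)}_i x^{(l)}_j)}{x^{(k)}_i x^{(l)}_j}\right\}^{\binom{s+n-i-j-1}{s-2}}.$$ Here the rows are indexed by the partitions $\lambda=(\lambda_1,\dots,\lambda_n)$ with $\lambda_1\le s-1$, arranged increasingly in the reverse lexicographic ordering, and the columns are indexed by $\mu\in Z_{s,n}$, arranged increasingly with respect to $<$.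
   Context: $Z_{s,n}=\{\mu=(\mu_1,\dots,\mu_s)\in\mathbb{Z}^s\mid \mu_i\ge0\text{ for all }i,\ \mu_1+\cdots+\mu_s=n\}$, totally ordered as follows: $\lambda<\mu$ if there is an index $k$ with $\lambda_1=\mu_1,\dots,\lambda_{k-1}=\mu_{k-1}$ and $\lambda_k>\mu_k$ (so $(n,0,\dots,0)$ comes first). For $\mu\in Z_{s,n}$, $X_\mu$ is the $n$-tuple $$X_\mu=(x^{(1)}_1,\dots,x^{(1)}_{\mu_1},x^{(2)}_1,\dots,x^{(2)}_{\mu_2},\dots,x^{(s)}_1,\dots,x^{(s)}_{\mu_s}).$$ $\lambda\subset((s-1)^n)$ means that $\lambda=(\lambda_1\ge\cdots\ge\lambda_n\ge0)$ is a sequence of integers with $\lambda_1\le s-1$. Reverse lexicographic ordering: $\lambda$ precedes $\mu$ if the first non-vanishing difference $\lambda_i-\mu_i$ is positive (so $((s-1)^n)$ comes first and the empty partition last). Binomial convention: $\binom{m}{r}=0$ whenever $r\ge0$ and $m<r$, including negative $m$. Thus the exponent $\binom{s+n-i-j-1}{s-2}$ is $0$ when $i+j>n+1$. For $s=1$ the products are empty and equal $1$. Classical group characters. For an $n$-tuple $X=(x_1,\dots,x_n)$ and a sequence $\alpha=(\alpha_1,\dots,\alpha_n)$ of integers or of half-integers, let $V(\alpha;X)=(x_i^{\alpha_j})_{1\le i,j\le n}$ and $W^{\pm}(\alpha;X)=(x_i^{\alpha_j}\pm x_i^{-\alpha_j})_{1\le i,j\le n}$ (with formal square roots $x_i^{1/2}$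 in the half-integer case). As $n$-tuples, $\delta(n-1)=(n-1,n-2,\dots,1,0)$, $\delta(n)=(n,n-1,\dots,1)$ and $\delta(n-1/2)=(n-1/2,n-3/2,\dots,1/2)$. For a partition $\lambda=(\lambda_1,\dots,\lambda_n)$ of length at most $n$: $$\mathbf{GL}_n(\lambda;X)=\frac{\det V(\lambda+\delta(n-1);X)}{\det V(\delta(n-1);X)},\qquad \mathbf{Sp}_{2n}(\lambda;X)=\frac{\det W^-(\lambda+\delta(n);X)}{\det W^-(\delta(n);X)},$$ $$\mathbf{O}_{2n+1}(\lambda;X)=\frac{\det W^-(\lambda+\delta(n-1/2);X)}{\det W^-(\delta(n-1/2);X)},$$ and $$\mathbf{O}_{2n}(\lambda;X)=\frac{\det W^+(\lambda+\delta(n-1);X)}{(1/2)\det W^+(\delta(n-1);X)}\ \text{ if }\lambda_n\ne0,\qquad \mathbf{O}_{2n}(\lambda;X)=\frac{\det W^+(\lambda+\delta(n-1);X)}{\det W^+(\delta(n-1);X)}\ \text{ if }\lambda_n=0.$$ *)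

theory Defs
  imports
    Jordan_Normal_Form.Determinant
    "HOL-Library.Poly_Mapping"
    "HOL-Library.Product_Lexorder"
    "HOL-Computational_Algebra.Fraction_Field"
begin

subsection \<open>The variables\<close>

text \<open>
  The ambient field is the field of rational functions, over an arbitrary field of
  characteristic zero, in the independent variables \<open>rt_var k i\<close>, which are the formal square
  roots of the variables \<open>x_var k i\<close>.  (The lexicographic order on pairs is only there
  because the library's \<open>idom\<close> instance for \<open>\<Rightarrow>\<^sub>0\<close> asks for linearly ordered indices.)
\<close>

type_synonym 'k ratfun = "(((nat \<times> nat) \<Rightarrow>\<^sub>0 nat) \<Rightarrow>\<^sub>0 'k) fract"

definition rt_var :: "nat \<Rightarrow> nat \<Rightarrow> 'k::field_char_0 ratfun" where
  "rt_var k i = Fract (Poly_Mapping.single (Poly_Mapping.single (k, i) 1) 1) 1"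

definition x_var :: "nat \<Rightarrow> nat \<Rightarrow> 'k::field_char_0 ratfun" where
  "x_var k i = (rt_var k i)\<^sup>2"

subsection \<open>Row and column indices\<close>

text \<open>Sequences of numbers are lists, so position \<open>i\<close> (from 1) is the list index \<open>i - 1\<close>.\<close>

definition Z :: "nat \<Rightarrow> nat \<Rightarrow> nat list set" where
  "Z s n = {mu. length mu = s \<and> sum_list mu = n}"

definition box_partitions :: "nat \<Rightarrow> nat \<Rightarrow> nat list set" where
  "box_partitions m n = {lam. length lam = n \<and> sorted_wrt (\<ge>) lam \<and> (\<forall>p\<in>set lam. p \<le> m)}"

text \<open>
  The order on \<open>Z s n\<close> and the reverse lexicographic order on partitions have the same
  description: the first entry in which the sequences differ is larger in the preceding one.
\<close>

definition precedes :: "nat list \<Rightarrow> nat list \<Rightarrow> bool" where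
  "precedes lam mu \<longleftrightarrow> (\<exists>k<length mu. (\<forall>i<k. lam ! i = mu ! i) \<and> lam ! k > mu ! k)"

definition ordered_list :: "nat list set \<Rightarrow> nat list list" where
  "ordered_list A = (THE xs. sorted_wrt precedes xs \<and> set xs = A)"

definition family_mat ::
  "nat list set \<Rightarrow> nat list set \<Rightarrow> (nat list \<Rightarrow> nat list \<Rightarrow> 'a) \<Rightarrow> 'a mat" where
  "family_mat A B f = mat (card A) (card B) (\<lambda>(a, b). f (ordered_list A ! a) (ordered_list B ! b))"

text \<open>\<open>ordered_list\<close> is well defined on the index sets used here.\<close>

lemma finite_lists_bounded: "finite {xs :: nat list. length xs = n \<and> (\<forall>p\<in>set xs. p \<le> m)}"
proof -
  have "{xs :: nat list. length xs = n \<and> (\<forall>p\<in>set xs. p \<le> m)} = {xs. set xs \<subseteq> {..m} \<and> length xs = n}"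
    by auto
  then show ?thesis
    using finite_lists_length_eq[of "{..m}" n] by simp
qed

lemma finite_box_partitions: "finite (box_partitions m n)"
  by (rule finite_subset[OF _ finite_lists_bounded[of n m]]) (auto simp: box_partitions_def)

lemma finite_Z: "finite (Z s n)"
  by (rule finite_subset[OF _ finite_lists_bounded[of s n]])
     (auto simp: Z_def dest: member_le_sum_list)

lemma precedes_irrefl: "\<not> precedes x x"
  by (simp add: precedes_def)

lemma precedes_trans:
  assumes "length x = n" "length y = n" "length z = n" "precedes x y" "precedes y z"
  shows "precedes x z"
proof -
  obtain k where k: "k < n" "\<forall>i<k. x ! i = y ! i" "x ! k > y ! k"
    using assms by (auto simp: precedes_def)
  obtain l where l: "l < n" "\<forall>i<l. y ! i = z ! i" "y ! l > z ! l"
    using assms by (auto simp: precedes_def)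
  have "x ! min k l > z ! min k l" "\<forall>i<min k l. x ! i = z ! i" "min k l < n"
    using k l by (cases k l rule: linorder_cases; force)+
  then show ?thesis
    using assms by (auto simp: precedes_def)
qed

lemma precedes_total:
  assumes "length x = n" "length y = n" "x \<noteq> y"
  shows "precedes x y \<or> precedes y x"
proof -
  define k where "k = (LEAST i. i < n \<and> x ! i \<noteq> y ! i)"
  have ex: "\<exists>i. i < n \<and> x ! i \<noteq> y ! i"
    using assms by (auto simp: list_eq_iff_nth_eq)
  have k: "k < n \<and> x ! k \<noteq> y ! k"
    unfolding k_def by (rule LeastI_ex[OF ex])
  have "\<forall>i<k. x ! i = y ! i"
    using not_less_Least k unfolding k_def by (metis (mono_tags, lifting) order.strict_trans)
  with k assms show ?thesis
    unfolding precedes_def by (metis linorder_neqE_nat)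
qed

lemma ex_ordered_list:
  assumes "finite A" "\<forall>x\<in>A. length x = n"
  shows "\<exists>xs. sorted_wrt precedes xs \<and> set xs = A"
  using assms
proof (induction A rule: finite_psubset_induct)
  case (psubset A)
  show ?case
  proof (cases "A = {}")
    case False
    have "transp_on A precedes"
      using precedes_trans psubset.prems by (metis transp_onI)
    moreover have "asymp_on A precedes"
      using precedes_trans precedes_irrefl psubset.prems by (metis asymp_onI)
    ultimately obtain m where m: "m \<in> A" "\<forall>x\<in>A. x \<noteq> m \<longrightarrow> \<not> precedes x m"
      using Finite_Set.bex_min_element[of A precedes] psubset.hyps False by blast
    obtain xs where xs: "sorted_wrt precedes xs" "set xs = A - {m}"
      using psubset.IH[of "A - {m}"] psubset.prems m by auto
    have "\<forall>x\<in>A - {m}. precedes m x"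
      using m precedes_total psubset.prems by blast
    then have "sorted_wrt precedes (m # xs) \<and> set (m # xs) = A"
      using xs m by auto
    then show ?thesis by blast
  qed auto
qed

lemma sorted_wrt_precedes_unique:
  assumes "sorted_wrt precedes xs" "sorted_wrt precedes ys" "set xs = set ys"
    "\<forall>x\<in>set xs. length x = n"
  shows "xs = ys"
  using assms
proof (induction xs arbitrary: ys)
  case Nil
  then show ?case by simp
next
  case (Cons x xs)
  obtain y zs where ys: "ys = y # zs"
    using Cons.prems by (cases ys) auto
  have "x = y"
    using Cons.prems ys precedes_trans precedes_irrefl
    by (metis list.set_intros(1) set_ConsD sorted_wrt.simps(2))
  moreover have "x \<notin> set xs" "y \<notin> set zs"
    using Cons.prems ys precedes_irrefl by auto
  ultimately have "set xs = set zs"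
    using Cons.prems ys by auto
  then show ?case
    using Cons ys \<open>x = y\<close> by auto
qed

lemma ordered_list:
  assumes "finite A" "\<forall>x\<in>A. length x = n"
  shows "sorted_wrt precedes (ordered_list A) \<and> set (ordered_list A) = A"
  unfolding ordered_list_def
  by (rule theI') (use ex_ordered_list[OF assms] sorted_wrt_precedes_unique assms in metis)

text \<open>The tuple \<open>X\<^sub>\<mu>\<close>, for a family \<open>z\<close> of variables or of their square roots.\<close>

definition tuple :: "(nat \<Rightarrow> nat \<Rightarrow> 'a) \<Rightarrow> nat list \<Rightarrow> 'a list" where
  "tuple z mu = concat (map (\<lambda>k. map (z k) [1..<Suc (mu ! (k - 1))]) [1..<Suc (length mu)])"

subsection \<open>Classical group characters\<close>

definition V :: "nat \<Rightarrow> (nat \<Rightarrow> int) \<Rightarrow> 'a::field list \<Rightarrow> 'a mat" where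
  "V n \<alpha> X = mat n n (\<lambda>(i, j). (X ! i) powi \<alpha> j)"

definition W_minus :: "nat \<Rightarrow> (nat \<Rightarrow> int) \<Rightarrow> 'a::field list \<Rightarrow> 'a mat" where
  "W_minus n \<alpha> X = mat n n (\<lambda>(i, j). (X ! i) powi \<alpha> j - (X ! i) powi (- \<alpha> j))"

definition W_plus :: "nat \<Rightarrow> (nat \<Rightarrow> int) \<Rightarrow> 'a::field list \<Rightarrow> 'a mat" where
  "W_plus n \<alpha> X = mat n n (\<lambda>(i, j). (X ! i) powi \<alpha> j + (X ! i) powi (- \<alpha> j))"

text \<open>\<open>\<delta> c\<close> is the sequence \<open>c, c - 1, c - 2, \<dots>\<close>\<close>

definition \<delta> :: "int \<Rightarrow> nat \<Rightarrow> int" where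
  "\<delta> c j = c - int j"

definition GL_char :: "nat \<Rightarrow> nat list \<Rightarrow> 'a::field list \<Rightarrow> 'a" where
  "GL_char n lam X =
     det (V n (\<lambda>j. int (lam ! j) + \<delta> (int n - 1) j) X) / det (V n (\<delta> (int n - 1)) X)"

text \<open>The group \<open>Sp\<close> of rank \<open>n\<close>, acting in dimension \<open>2n\<close>.\<close>

definition Sp_char :: "nat \<Rightarrow> nat list \<Rightarrow> 'a::field list \<Rightarrow> 'a" where
  "Sp_char n lam X =
     det (W_minus n (\<lambda>j. int (lam ! j) + \<delta> (int n) j) X) / det (W_minus n (\<delta> (int n)) X)"

text \<open>
  For the orthogonal group in dimension \<open>2n + 1\<close> the last argument \<open>R\<close> is the tuple of square
  roots of the variables: the power of \<open>x\<^sub>i\<close> with half-integer exponent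
  \<open>a = \<lambda>\<^sub>j + \<delta>(n - 1/2)\<^sub>j\<close> is the power of \<open>R ! i\<close> with integer exponent \<open>2 a\<close>.  With \<open>j\<close>
  counted from 0, twice \<open>\<delta>(n - 1/2)\<^sub>j\<close> is \<open>2 \<delta>(n)\<^sub>j - 1\<close>.
\<close>

definition O_odd_char :: "nat \<Rightarrow> nat list \<Rightarrow> 'a::field list \<Rightarrow> 'a" where
  "O_odd_char n lam R =
     det (W_minus n (\<lambda>j. 2 * int (lam ! j) + (2 * \<delta> (int n) j - 1)) R) /
     det (W_minus n (\<lambda>j. 2 * \<delta> (int n) j - 1) R)"

definition O_even_char :: "nat \<Rightarrow> nat list \<Rightarrow> 'a::field list \<Rightarrow> 'a" where
  "O_even_char n lam X =
     (if lam ! (n - 1) \<noteq> 0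
      then det (W_plus n (\<lambda>j. int (lam ! j) + \<delta> (int n - 1) j) X) /
             ((1 / 2) * det (W_plus n (\<delta> (int n - 1)) X))
      else det (W_plus n (\<lambda>j. int (lam ! j) + \<delta> (int n - 1) j) X) /
             det (W_plus n (\<delta> (int n - 1)) X))"

subsection \<open>The exponents\<close>

text \<open>
  The test for negative \<open>m\<close> matters for \<open>r = 0\<close>, where \<open>nat m choose 0 = 1\<close>.
\<close>

definition binom :: "int \<Rightarrow> nat \<Rightarrow> nat" where
  "binom m r = (if m < 0 then 0 else nat m choose r)"

end

theory Submission
  imports Defs "HOL-Computational_Algebra.Polynomial"
begin

text \<open>
  After cancelling a common factor from numerator and denominator, all four kinds of characters are
  ratios of alternants \<open>det (p\<^sub>m (t\<^sub>i))\<close> with \<open>m = \<lambda>\<^sub>j + n - j\<close>, where the \<open>p\<^sub>m\<close> are monic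
  of degree \<open>m\<close> and \<open>t = x\<close> for \<open>GL\<close>, \<open>t = x + 1 / x\<close> otherwise.  The big determinant is
  invariant under unitriangular changes of the basis \<open>p\<close>, so only Schur functions remain.

  For these let \<open>a\<close> be the first variable and replace \<open>t\<^sup>m\<close> by \<open>t\<^sup>m (1 - t / a)\<close>, except in the
  highest degree.  All but the last basis element now vanish at \<open>a\<close>, and the determinant
  becomes block triangular: one block is the determinant for \<open>(s, n - 1)\<close>, with \<open>a\<close> removed from
  the first alphabet, and the other is the one for \<open>(s - 1, n)\<close>, with the first alphabet removed.
  The exponents follow by Pascal's rule.
\<close>

subsection \<open>Alternants and changes of basis\<close>

text \<open>Changing the whole basis at once would act on the alternants through a compound matrix
  of minors, and the partitions would have to be ordered suitably to see that it is unitriangular.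
  Replacing a single polynomial \<open>p a\<close> avoids this: the correction leads from partitions
  whose degrees include \<open>a\<close> to partitions whose degrees do not. The row operations then
  have the form \<open>1 + C\<close> with \<open>C\<close> of square zero, and their determinant is
  1 whatever the order of the partitions and the signs from sorting. Denominators depend on the
  column only and do not interfere.

  The factor is \<open>1 - t / a\<close> rather than \<open>a - t\<close> so that the coefficient of
  \<open>t^m\<close> stays 1. The powers of \<open>a\<close> that this creates in the two diagonal
  blocks cancel because of a relation between the block sizes.

  The induction shifts and shortens alphabets and serves both \<open>x\<close> and
  \<open>x + 1 / x\<close>; it is therefore carried out for arbitrary families of distinct nonzero
  field elements.\<close>

lemma det_scale_rows:
  fixes f :: "nat \<Rightarrow> nat \<Rightarrow> 'a::comm_ring_1"
  shows "det (mat n n (\<lambda>(i, j). r i * f i j)) = (\<Prod>i<n. r i) * det (mat n n (\<lambda>(i, j). f i j))"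
proof -
  have "signof p * (\<Prod>i = 0..<n. r i * f i (p i)) = (\<Prod>i<n. r i) * (signof p * (\<Prod>i = 0..<n. f i (p i)))"
    for p :: "nat \<Rightarrow> nat"
    by (simp add: prod.distrib atLeast0LessThan ac_simps)
  then show ?thesis
    by (subst (1 2) det_def'[of _ n]) (auto simp: sum_distrib_left intro!: sum.cong)
qed

lemma det_scale_cols:
  fixes f :: "nat \<Rightarrow> nat \<Rightarrow> 'a::comm_ring_1"
  shows "det (mat n n (\<lambda>(i, j). c j * f i j)) = (\<Prod>j<n. c j) * det (mat n n (\<lambda>(i, j). f i j))"
proof -
  have tr: "det (mat n n (\<lambda>(i, j). g i j)) = det (mat n n (\<lambda>(i, j). g j i))"
    for g :: "nat \<Rightarrow> nat \<Rightarrow> 'a"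
    by (subst det_transpose[symmetric, of _ n]) (auto intro!: arg_cong[where f = det])
  show ?thesis
    by (subst (1 2) tr) (rule det_scale_rows)
qed

text \<open>Basis \<open>p\<close> and degrees \<open>\<alpha>\<close> are kept apart: the basis can
  change under fixed degrees, and a degree can be exchanged under a fixed basis.\<close>

definition alternant :: "nat \<Rightarrow> (nat \<Rightarrow> 'a::field poly) \<Rightarrow> (nat \<Rightarrow> nat) \<Rightarrow> 'a list \<Rightarrow> 'a" where
  "alternant n p \<alpha> T = det (mat n n (\<lambda>(i, j). poly (p (\<alpha> j)) (T ! i)))"

text \<open>The sequence \<open>\<lambda> + \<delta>(n - 1)\<close>; for \<open>j < n\<close> the
  subtraction of naturals is exact.\<close>

definition exps :: "nat \<Rightarrow> nat list \<Rightarrow> nat \<Rightarrow> nat" where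
  "exps n lam j = lam ! j + (n - 1 - j)"

lemma alternant_cong:
  assumes "\<And>j. j < n \<Longrightarrow> p (\<alpha> j) = q (\<beta> j)" and "\<And>i. i < n \<Longrightarrow> T ! i = U ! i"
  shows "alternant n p \<alpha> T = alternant n q \<beta> U"
  using assms unfolding alternant_def by (intro arg_cong[where f = det] eq_matI) auto

lemma alternant_permute:
  assumes "\<pi> permutes {0..<n}"
  shows "alternant n p (\<alpha> \<circ> \<pi>) T = signof \<pi> * alternant n p \<alpha> T"
proof -
  let ?A = "mat n n (\<lambda>(i, j). poly (p (\<alpha> i)) (T ! j))"
  have tr: "alternant n p \<alpha> T = det (mat n n (\<lambda>(i, j). poly (p (\<alpha> i)) (T ! j)))" for \<alpha>
    unfolding alternant_def
    by (subst det_transpose[symmetric, of _ n]) (auto intro!: arg_cong[where f = det])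
  have "alternant n p (\<alpha> \<circ> \<pi>) T = det (mat n n (\<lambda>(i, j). ?A $$ (\<pi> i, j)))"
    unfolding tr using permutes_in_image[OF assms]
    by (intro arg_cong[where f = det] eq_matI) auto
  also have "\<dots> = signof \<pi> * det ?A"
    by (rule det_permute_rows) (use assms in auto)
  finally show ?thesis by (simp add: tr)
qed

lemma alternant_eq_0:
  assumes "i < n" "j < n" "i \<noteq> j" "\<alpha> i = \<alpha> j"
  shows "alternant n p \<alpha> T = 0"
  unfolding alternant_def
  by (rule det_identical_columns[of _ n i j]) (use assms in \<open>auto intro!: eq_vecI\<close>)

section \<open>Partitions in a box as strictly decreasing sequences of degrees\<close>

lemma exps_strict_mono:
  assumes "lam \<in> box_partitions m n" "i < j" "j < n"
  shows "exps n lam j < exps n lam i"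
proof -
  have "lam ! j \<le> lam ! i"
    using assms by (auto simp: box_partitions_def sorted_wrt_iff_nth_less)
  then show ?thesis
    using assms by (auto simp: exps_def)
qed

lemma exps_bound:
  assumes "lam \<in> box_partitions m n" "j < n"
  shows "exps n lam j < m + n"
proof -
  have "lam ! j \<le> m"
    using assms by (auto simp: box_partitions_def)
  then show ?thesis
    using assms by (auto simp: exps_def)
qed

lemma exps_inj:
  assumes "lam \<in> box_partitions m n"
  shows "inj_on (exps n lam) {..<n}"
  by (rule linorder_inj_onI') (use exps_strict_mono[OF assms] in fastforce)

text \<open>Strict descent forces a drop of at least \<open>j - i\<close> between positions
  \<open>i\<close> and \<open>j\<close>. Compared with the last entry this gives
  \<open>L ! j \<ge> n - 1 - j\<close>, so that \<open>\<delta>(n - 1)\<close> can be subtracted;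
  compared with the first entry it bounds the parts by \<open>m\<close>.\<close>

lemma exps_surj:
  assumes "length L = n" "sorted_wrt (>) L" "\<forall>x\<in>set L. x < m + n"
  obtains lam where "lam \<in> box_partitions m n" "\<And>j. j < n \<Longrightarrow> exps n lam j = L ! j"
proof
  have less: "L ! j + (j - i) \<le> L ! i" if "i \<le> j" "j < n" for i j
    using that
  proof (induction "j - i" arbitrary: j)
    case (Suc d)
    then obtain j' where j': "j = Suc j'" "i \<le> j'" by (cases j) auto
    have "L ! j < L ! j'"
      using assms Suc j' by (auto simp: sorted_wrt_iff_nth_less)
    moreover have "L ! j' + (j' - i) \<le> L ! i"
      using Suc j' by auto
    ultimately show ?case using j' by auto
  qed auto
  define lam where "lam = map (\<lambda>j. L ! j - (n - 1 - j)) [0..<n]"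
  have ge: "n - 1 - j \<le> L ! j" if "j < n" for j
  proof -
    have "L ! (n - 1) + (n - 1 - j) \<le> L ! j"
      by (rule less) (use that in auto)
    then show ?thesis by linarith
  qed
  have bnd: "L ! j - (n - 1 - j) \<le> m" if "j < n" for j
  proof -
    have "L ! j + j \<le> L ! 0" "L ! 0 < m + n"
      using less[of 0 j] assms that by auto
    then show ?thesis using that by auto
  qed
  have "L ! j - (n - 1 - j) \<le> L ! i - (n - 1 - i)" if "i < j" "j < n" for i j
    using less[of i j] that by linarith
  then have "sorted_wrt (\<ge>) lam"
    by (simp add: lam_def sorted_wrt_iff_nth_less)
  then show "lam \<in> box_partitions m n"
    using bnd by (auto simp: box_partitions_def lam_def)
  show "exps n lam j = L ! j" if "j < n" for j
    using ge[OF that] that by (auto simp: exps_def lam_def)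
qed

text \<open>Exchanging one degree spoils the decreasing order; this restores it. The quantifiers
  matter: \<open>\<epsilon>\<close> is the same for all \<open>p\<close> and \<open>T\<close>, so it
  can enter a row operation that is common to all columns of the big matrix.\<close>

lemma alternant_sort:
  assumes inj: "inj_on \<gamma> {..<n}" and bnd: "\<And>j. j < n \<Longrightarrow> \<gamma> j < m + n"
  shows "\<exists>\<beta>\<in>box_partitions m n. exps n \<beta> ` {..<n} = \<gamma> ` {..<n} \<and>
    (\<exists>\<epsilon>::'a::field. \<forall>p T. alternant n p \<gamma> T = \<epsilon> * alternant n p (exps n \<beta>) T)"
proof -
  define G where "G = map \<gamma> [0..<n]"
  define L where "L = rev (sort G)"
  have dG: "distinct G"
    using inj by (auto simp: G_def distinct_map atLeast0LessThan)
  have len: "length L = n" "length G = n" by (auto simp: L_def G_def)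
  have "sorted_wrt (<) (sort G)"
    using dG by (simp add: strict_sorted_iff)
  then have "sorted_wrt (>) L"
    by (simp add: L_def sorted_wrt_rev)
  moreover have setL: "set L = \<gamma> ` {..<n}"
    by (auto simp: L_def G_def)
  ultimately obtain \<beta> where \<beta>: "\<beta> \<in> box_partitions m n" "\<And>j. j < n \<Longrightarrow> exps n \<beta> j = L ! j"
    using exps_surj[of L n m] bnd len by auto
  have "mset G = mset L" by (simp add: L_def)
  then obtain \<pi> where \<pi>: "\<pi> permutes {..<length L}" "permute_list \<pi> L = G"
    using mset_eq_permutation by blast
  have \<gamma>: "\<gamma> j = exps n \<beta> (\<pi> j)" if "j < n" for j
  proof -
    have "\<gamma> j = G ! j" using that by (simp add: G_def)
    also have "\<dots> = L ! \<pi> j"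
      using \<pi> permute_list_nth[of \<pi> L j] len that by auto
    also have "\<dots> = exps n \<beta> (\<pi> j)"
      using \<pi>(1) len that permutes_in_image[of \<pi> "{..<n}" j] by (auto simp: \<beta>)
    finally show ?thesis .
  qed
  have "alternant n p \<gamma> T = signof \<pi> * alternant n p (exps n \<beta>) T" for p :: "nat \<Rightarrow> 'a poly" and T
  proof -
    have "alternant n p \<gamma> T = alternant n p (exps n \<beta> \<circ> \<pi>) T"
      by (rule alternant_cong) (auto simp: \<gamma>)
    also have "\<dots> = signof \<pi> * alternant n p (exps n \<beta>) T"
      by (rule alternant_permute) (use \<pi> len in \<open>auto simp: atLeast0LessThan\<close>)
    finally show ?thesis .
  qed
  moreover have "exps n \<beta> ` {..<n} = set L"
    using \<beta>(2) len by (force simp: in_set_conv_nth image_iff)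
  ultimately show ?thesis
    using \<beta>(1) setL by blast
qed

text \<open>Since \<open>\<alpha>\<close> is injective, changing \<open>p\<close> at
  \<open>\<alpha> j\<close> affects column \<open>j\<close> alone, and the determinant is linear in
  that column.\<close>

lemma alternant_linear:
  fixes c :: "nat \<Rightarrow> 'a::field"
  assumes "finite M" "j < n" "inj_on \<alpha> {..<n}"
  shows "alternant n (p(\<alpha> j := p (\<alpha> j) + (\<Sum>k\<in>M. smult (c k) (p k)))) \<alpha> T =
    alternant n p \<alpha> T + (\<Sum>k\<in>M. c k * alternant n p (\<alpha>(j := k)) T)"
proof -
  let ?A = "\<lambda>u. mat n n (\<lambda>(i, j'). if j' = j then u i else poly (p (\<alpha> j')) (T ! i))"
  \<comment> \<open>Laplace expansion along column \<open>j\<close>: the cofactors do not see this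
    column, so they may be computed with zeros in it, and linearity in \<open>u\<close> becomes
    visible.\<close>
  have lap: "det (?A u) = (\<Sum>i<n. u i * cofactor (?A (\<lambda>_. 0)) i j)" for u
  proof -
    have "det (?A u) = (\<Sum>i<n. ?A u $$ (i, j) * cofactor (?A u) i j)"
      by (rule laplace_expansion_column) (use assms in auto)
    also have "\<dots> = (\<Sum>i<n. u i * cofactor (?A (\<lambda>_. 0)) i j)"
    proof (rule sum.cong)
      fix i assume i: "i \<in> {..<n}"
      have "mat_delete (?A u) i j = mat_delete (?A (\<lambda>_. 0)) i j"
        unfolding mat_delete_def using assms i by (intro eq_matI) auto
      then show "?A u $$ (i, j) * cofactor (?A u) i j = u i * cofactor (?A (\<lambda>_. 0)) i j"
        using assms i by (simp add: cofactor_def)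
    qed auto
    finally show ?thesis .
  qed
  have ne: "\<alpha> j' \<noteq> \<alpha> j" if "j' < n" "j' \<noteq> j" for j'
    using assms that by (auto dest: inj_onD)
  have 1: "alternant n (p(\<alpha> j := p (\<alpha> j) + (\<Sum>k\<in>M. smult (c k) (p k)))) \<alpha> T =
      det (?A (\<lambda>i. poly (p (\<alpha> j)) (T ! i) + (\<Sum>k\<in>M. c k * poly (p k) (T ! i))))"
    unfolding alternant_def using ne
    by (intro arg_cong[where f = det] eq_matI) (auto simp: poly_sum)
  have 2: "alternant n p \<alpha> T = det (?A (\<lambda>i. poly (p (\<alpha> j)) (T ! i)))"
    unfolding alternant_def by (intro arg_cong[where f = det] eq_matI) auto
  have 3: "alternant n p (\<alpha>(j := k)) T = det (?A (\<lambda>i. poly (p k) (T ! i)))" for k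
    unfolding alternant_def by (intro arg_cong[where f = det] eq_matI) auto
  show ?thesis
    unfolding 1 2 3 lap
    by (simp add: algebra_simps sum.distrib sum_distrib_left sum_distrib_right)
       (rule sum.swap)
qed

text \<open>By linearity the degree \<open>a\<close> is exchanged for each \<open>k\<close> in
  \<open>M\<close>. A \<open>k\<close> already among the degrees produces two equal columns; any
  other \<open>k\<close> gives, after sorting, a partition whose degrees omit \<open>a\<close>. The
  condition on \<open>C\<close> records this passage and makes \<open>C\<close> square to
  zero.\<close>

lemma alternant_step:
  fixes c :: "nat \<Rightarrow> 'a::field"
  assumes "lam \<in> box_partitions m n" "a \<notin> M" "M \<subseteq> {..<m + n}"
  shows "\<exists>C. (\<forall>\<beta>. C \<beta> \<noteq> 0 \<longrightarrow> a \<in> exps n lam ` {..<n} \<and> a \<notin> exps n \<beta> ` {..<n}) \<and>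
    (\<forall>T. alternant n (p(a := p a + (\<Sum>k\<in>M. smult (c k) (p k)))) (exps n lam) T =
      alternant n p (exps n lam) T +
      (\<Sum>\<beta>\<in>box_partitions m n. C \<beta> * alternant n p (exps n \<beta>) T))"
proof (cases "a \<in> exps n lam ` {..<n}")
  case False
  then have "alternant n (p(a := p a + (\<Sum>k\<in>M. smult (c k) (p k)))) (exps n lam) T =
      alternant n p (exps n lam) T" for T
    by (intro alternant_cong) (auto simp: image_iff)
  then show ?thesis by (intro exI[of _ "\<lambda>_. 0"]) auto
next
  case True
  then obtain j where j: "j < n" "a = exps n lam j" by auto
  let ?\<alpha> = "exps n lam"
  define K where "K = M - ?\<alpha> ` {..<n}"
  have finM: "finite M" using assms finite_subset by blast
  have "\<exists>\<beta> \<epsilon>. \<beta> \<in> box_partitions m n \<and> a \<notin> exps n \<beta> ` {..<n} \<and>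
      (\<forall>T. alternant n p (?\<alpha>(j := k)) T = \<epsilon> * alternant n p (exps n \<beta>) T)" if k: "k \<in> K" for k
  proof -
    have inj: "inj_on (?\<alpha>(j := k)) {..<n}"
      using exps_inj[OF assms(1)] k unfolding K_def inj_on_def by auto
    have na: "a \<notin> (?\<alpha>(j := k)) ` {..<n}"
      using exps_inj[OF assms(1)] j k True by (auto simp: K_def inj_on_def)
    have "(?\<alpha>(j := k)) i < m + n" if "i < n" for i
      using exps_bound[OF assms(1) that] k assms by (auto simp: K_def)
    from alternant_sort[OF inj this, where 'a = 'a] na show ?thesis by metis
  qed
  then obtain b \<epsilon> where b: "b k \<in> box_partitions m n" "a \<notin> exps n (b k) ` {..<n}"
      "alternant n p (?\<alpha>(j := k)) T = \<epsilon> k * alternant n p (exps n (b k)) T" if "k \<in> K" for k T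
    by metis
  define C where "C \<beta> = (\<Sum>k\<in>{k \<in> K. b k = \<beta>}. c k * \<epsilon> k)" for \<beta>
  have finK: "finite K" using finM by (simp add: K_def)
  have "alternant n (p(a := p a + (\<Sum>k\<in>M. smult (c k) (p k)))) ?\<alpha> T =
      alternant n p ?\<alpha> T + (\<Sum>\<beta>\<in>box_partitions m n. C \<beta> * alternant n p (exps n \<beta>) T)" for T
  proof -
    have "(\<Sum>k\<in>M. c k * alternant n p (?\<alpha>(j := k)) T) =
        (\<Sum>k\<in>K. c k * alternant n p (?\<alpha>(j := k)) T)"
    proof (rule sum.mono_neutral_right)
      show "\<forall>k\<in>M - K. c k * alternant n p (?\<alpha>(j := k)) T = 0"
      proof
        fix k assume "k \<in> M - K"
        then obtain i where i: "i < n" "k = ?\<alpha> i" "k \<in> M" by (auto simp: K_def)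
        with assms j have "i \<noteq> j" by auto
        then have "alternant n p (?\<alpha>(j := k)) T = 0"
          using i j by (intro alternant_eq_0[of i n j]) auto
        then show "c k * alternant n p (?\<alpha>(j := k)) T = 0" by simp
      qed
    qed (auto simp: K_def finM)
    also have "\<dots> = (\<Sum>k\<in>K. c k * \<epsilon> k * alternant n p (exps n (b k)) T)"
      by (intro sum.cong) (auto simp: b)
    also have "\<dots> = (\<Sum>\<beta>\<in>box_partitions m n. \<Sum>k\<in>{k \<in> K. b k = \<beta>}.
        c k * \<epsilon> k * alternant n p (exps n (b k)) T)"
      by (rule sum.group[symmetric]) (use finK b finite_box_partitions in auto)
    also have "\<dots> = (\<Sum>\<beta>\<in>box_partitions m n. C \<beta> * alternant n p (exps n \<beta>) T)"
      unfolding C_def by (intro sum.cong) (auto simp: sum_distrib_right)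
    finally show ?thesis
      using alternant_linear[OF finM j(1) exps_inj[OF assms(1)], of p c T] j by simp
  qed
  moreover have "\<forall>\<beta>. C \<beta> \<noteq> 0 \<longrightarrow> a \<in> exps n lam ` {..<n} \<and> a \<notin> exps n \<beta> ` {..<n}"
  proof (intro allI impI conjI)
    fix \<beta> assume "C \<beta> \<noteq> 0"
    then have "{k \<in> K. b k = \<beta>} \<noteq> {}" unfolding C_def by (metis sum.empty)
    then show "a \<notin> exps n \<beta> ` {..<n}" using b by auto
  qed (use True in auto)
  ultimately show ?thesis by blast
qed

text \<open>A permutation other than the identity moves some \<open>i\<close>, and then also
  \<open>p i\<close>. Its product contains the off-diagonal entries \<open>C i (p i)\<close> and
  \<open>C (p i) (p (p i))\<close>, which would require both the failure and the truth of
  \<open>Q (p i)\<close>. Only the identity contributes to the determinant.\<close>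

lemma det_one_plus_square_zero:
  fixes C :: "nat \<Rightarrow> nat \<Rightarrow> 'a::idom"
  assumes "\<And>i j. i < R \<Longrightarrow> j < R \<Longrightarrow> C i j \<noteq> 0 \<Longrightarrow> Q i \<and> \<not> Q j"
  shows "det (mat R R (\<lambda>(i, j). (if i = j then 1 else 0) + C i j)) = 1"
proof -
  let ?A = "mat R R (\<lambda>(i, j). (if i = j then 1 else 0) + C i j)"
  have z: "(\<Prod>i = 0..<R. ?A $$ (i, p i)) = 0" if p: "p permutes {0..<R}" "p \<noteq> id" for p
  proof -
    obtain i where i: "p i \<noteq> i" using p by (auto simp: fun_eq_iff)
    then have iR: "i < R" "p i < R"
      using p permutes_in_image[OF p(1)] permutes_not_in[OF p(1)] by auto
    have neq: "p (p i) \<noteq> p i" using permutes_inj[OF p(1)] i by (metis injD)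
    have pp: "p (p i) < R" using iR permutes_in_image[OF p(1)] by auto
    have "C i (p i) = 0 \<or> C (p i) (p (p i)) = 0"
      using assms[of i "p i"] assms[of "p i" "p (p i)"] iR pp by blast
    then have "?A $$ (i, p i) = 0 \<or> ?A $$ (p i, p (p i)) = 0"
      using iR pp i neq by auto
    then have "\<exists>i\<in>{0..<R}. ?A $$ (i, p i) = 0"
      using iR by (meson atLeastLessThan_iff le0)
    then show ?thesis by (intro prod_zero) auto
  qed
  have d: "C i i = 0" if "i < R" for i using assms[of i i] that by blast
  have "det ?A = (\<Sum>p | p permutes {0..<R}. signof p * (\<Prod>i = 0..<R. ?A $$ (i, p i)))"
    by (rule det_def') auto
  also have "\<dots> = (\<Sum>p\<in>{id}. signof p * (\<Prod>i = 0..<R. ?A $$ (i, p i)))"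
    by (rule sum.mono_neutral_right) (use z in \<open>auto simp: finite_permutations permutes_id\<close>)
  also have "\<dots> = 1" using d by auto
  finally show ?thesis .
qed

section \<open>Row operations on matrices indexed by ordered families\<close>

lemma distinct_ordered_list:
  assumes "finite A" "\<forall>x\<in>A. length x = n"
  shows "distinct (ordered_list A)" "set (ordered_list A) = A" "length (ordered_list A) = card A"
proof -
  have o: "sorted_wrt precedes (ordered_list A)" "set (ordered_list A) = A"
    using ordered_list[OF assms] by auto
  then show "set (ordered_list A) = A" by simp
  show "distinct (ordered_list A)"
    unfolding distinct_conv_nth
    using o(1) precedes_irrefl by (metis linorder_neqE_nat sorted_wrt_nth_less)
  then show "length (ordered_list A) = card A"
    using distinct_card o(2) by metis
qed

lemma family_mat_cong:
  assumes "finite A" "\<forall>x\<in>A. length x = n" "finite B" "\<forall>x\<in>B. length x = k"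
    "\<And>a b. a \<in> A \<Longrightarrow> b \<in> B \<Longrightarrow> f a b = g a b"
  shows "family_mat A B f = family_mat A B g"
proof -
  note A = distinct_ordered_list[OF assms(1,2)] and B = distinct_ordered_list[OF assms(3,4)]
  have "ordered_list A ! i \<in> A" if "i < card A" for i using A that nth_mem by metis
  moreover have "ordered_list B ! i \<in> B" if "i < card B" for i using B that nth_mem by metis
  ultimately show ?thesis
    unfolding family_mat_def using assms(5) by (intro eq_matI) auto
qed

text \<open>\<open>C\<close> does not depend on the column \<open>b\<close>, so the new matrix is
  the old one multiplied from the left by \<open>1 + C\<close>.\<close>

lemma det_family_mat_row_operations:
  fixes h h' :: "nat list \<Rightarrow> nat list \<Rightarrow> 'a::idom"
  assumes A: "finite A" "\<forall>x\<in>A. length x = n" and B: "finite B" "\<forall>x\<in>B. length x = k"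
    and card: "card A = card B"
    and h': "\<And>a b. a \<in> A \<Longrightarrow> b \<in> B \<Longrightarrow> h' a b = h a b + (\<Sum>c\<in>A. C a c * h c b)"
    and Q: "\<And>a c. C a c \<noteq> 0 \<Longrightarrow> Q a \<and> \<not> Q c"
  shows "det (family_mat A B h') = det (family_mat A B h)"
proof -
  let ?R = "card A" and ?r = "\<lambda>i. ordered_list A ! i" and ?s = "\<lambda>i. ordered_list B ! i"
  let ?U = "mat ?R ?R (\<lambda>(i, j). (if i = j then 1 else 0) + C (?r i) (?r j))"
  note oA = distinct_ordered_list[OF A] and oB = distinct_ordered_list[OF B]
  have bij: "bij_betw ?r {0..<?R} A"
    using bij_betw_nth[OF oA(1)] oA by (auto simp: atLeast0LessThan)
  have inA: "?r i \<in> A" if "i < ?R" for i using oA that nth_mem by metis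
  have inB: "?s i \<in> B" if "i < ?R" for i using oB card that nth_mem by metis
  have "family_mat A B h' = ?U * family_mat A B h"
  proof (rule eq_matI)
    fix i j assume "i < dim_row (?U * family_mat A B h)" "j < dim_col (?U * family_mat A B h)"
    then have ij: "i < ?R" "j < ?R" using card by (auto simp: family_mat_def)
    have "(?U * family_mat A B h) $$ (i, j) =
        (\<Sum>l = 0..<?R. ((if i = l then 1 else 0) + C (?r i) (?r l)) * h (?r l) (?s j))"
      using ij card by (simp add: family_mat_def scalar_prod_def)
    also have "\<dots> = (\<Sum>l = 0..<?R. (if i = l then h (?r l) (?s j) else 0)) +
        (\<Sum>l = 0..<?R. C (?r i) (?r l) * h (?r l) (?s j))"
      unfolding sum.distrib[symmetric] by (intro sum.cong) (auto simp: algebra_simps)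
    also have "\<dots> = h (?r i) (?s j) + (\<Sum>c\<in>A. C (?r i) c * h c (?s j))"
      using ij sum.reindex_bij_betw[OF bij, of "\<lambda>c. C (?r i) c * h c (?s j)"] by simp
    also have "\<dots> = family_mat A B h' $$ (i, j)"
      using ij card h'[OF inA inB] by (simp add: family_mat_def)
    finally show "family_mat A B h' $$ (i, j) = (?U * family_mat A B h) $$ (i, j)" by simp
  qed (auto simp: family_mat_def)
  moreover have "det ?U = 1"
    by (rule det_one_plus_square_zero[where Q = "\<lambda>i. Q (?r i)"]) (use Q in blast)
  ultimately show ?thesis
    using det_mult[of ?U ?R "family_mat A B h"] card by (simp add: family_mat_def)
qed

text \<open>The rank \<open>r\<close> prescribes the order in which the polynomials are replaced.\<close>

lemma det_family_mat_alternant_change_basis: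
  fixes p q :: "nat \<Rightarrow> 'a::field poly"
  assumes B: "finite B" "\<forall>x\<in>B. length x = k" and card: "card (box_partitions m n) = card B"
    and r: "inj_on r {..<m + n}"
    and q: "\<And>a. a < m + n \<Longrightarrow> q a = p a + (\<Sum>b\<in>{b. b < m + n \<and> r b > (r a :: nat)}. smult (c a b) (p b))"
  shows "det (family_mat (box_partitions m n) B (\<lambda>lam mu. w mu * alternant n q (exps n lam) (T mu))) =
         det (family_mat (box_partitions m n) B (\<lambda>lam mu. w mu * alternant n p (exps n lam) (T mu)))"
proof -
  note box = finite_box_partitions[of m n]
  have boxl: "\<forall>x\<in>box_partitions m n. length x = n" by (auto simp: box_partitions_def)
  \<comment> \<open>The intermediate basis: the polynomials of rank below \<open>t\<close> have been
    replaced. Passing from \<open>t\<close> to \<open>t + 1\<close> replaces at most one, as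
    \<open>r\<close> is injective.\<close>
  define g where "g t a = (if r a < t then q a else p a)" for t a
  let ?D = "\<lambda>p. det (family_mat (box_partitions m n) B
      (\<lambda>lam mu. w mu * alternant n p (exps n lam) (T mu)))"
  have cong: "?D p = ?D q" if "\<And>a. a < m + n \<Longrightarrow> p a = q a" for p q
    by (intro arg_cong[where f = det] family_mat_cong[OF box boxl B]
        arg_cong2[where f = "(*)"] alternant_cong) (use that exps_bound in auto)
  have replaced: "?D (g t) = ?D p" for t
  proof (induction t)
    case 0
    then show ?case by (simp add: g_def)
  next
    case (Suc t)
    have "?D (g (Suc t)) = ?D (g t)"
    proof (cases "\<exists>a<m + n. r a = t")
      case False
      then show ?thesis by (intro cong) (auto simp: g_def less_Suc_eq)
    next
      case True
      then obtain a where a: "a < m + n" "r a = t" by auto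
      define M where "M = {b. b < m + n \<and> r b > r a}"
      let ?g' = "(g t)(a := g t a + (\<Sum>b\<in>M. smult (c a b) (g t b)))"
      have "?D (g (Suc t)) = ?D ?g'"
      proof (rule cong)
        fix b assume b: "b < m + n"
        show "g (Suc t) b = ?g' b"
        proof (cases "b = a")
          case True
          \<comment> \<open>The polynomials in the correction have rank above \<open>t\<close> and
            are still the old ones, so the formula for \<open>q a\<close> in terms of
            \<open>p\<close> is also one in terms of \<open>g t\<close>.\<close>
          have "(\<Sum>b\<in>M. smult (c a b) (g t b)) = (\<Sum>b\<in>M. smult (c a b) (p b))"
            by (intro sum.cong) (auto simp: M_def g_def a)
          then show ?thesis using True a q[OF a(1)] by (simp add: g_def M_def)
        next
          case False
          then have "r b \<noteq> t" using a b r by (auto dest: inj_onD)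
          then show ?thesis using False by (auto simp: g_def)
        qed
      qed
      also have "?D ?g' = ?D (g t)"
      proof -
        have M: "a \<notin> M" "M \<subseteq> {..<m + n}" by (auto simp: M_def)
        have "\<forall>lam. \<exists>C. lam \<in> box_partitions m n \<longrightarrow>
            (\<forall>\<beta>. C \<beta> \<noteq> 0 \<longrightarrow> a \<in> exps n lam ` {..<n} \<and> a \<notin> exps n \<beta> ` {..<n}) \<and>
            (\<forall>T. alternant n ?g' (exps n lam) T = alternant n (g t) (exps n lam) T +
              (\<Sum>\<beta>\<in>box_partitions m n. C \<beta> * alternant n (g t) (exps n \<beta>) T))"
          using alternant_step[OF _ M, where p = "g t" and c = "c a"] by auto
        then obtain C where C: "\<And>lam \<beta>. lam \<in> box_partitions m n \<Longrightarrow> C lam \<beta> \<noteq> 0 \<Longrightarrow>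
              a \<in> exps n lam ` {..<n} \<and> a \<notin> exps n \<beta> ` {..<n}"
            "\<And>lam T. lam \<in> box_partitions m n \<Longrightarrow> alternant n ?g' (exps n lam) T =
              alternant n (g t) (exps n lam) T +
              (\<Sum>\<beta>\<in>box_partitions m n. C lam \<beta> * alternant n (g t) (exps n \<beta>) T)"
          unfolding choice_iff by blast
        \<comment> \<open>Set to zero outside the box, because the condition with \<open>Q\<close>
          is required for all lists.\<close>
        define C' where "C' lam = (if lam \<in> box_partitions m n then C lam else (\<lambda>_. 0))" for lam
        show ?thesis
        proof (rule det_family_mat_row_operations[OF box boxl B card, where C = C' and
                Q = "\<lambda>lam. a \<in> exps n lam ` {..<n}"])
          fix lam mu assume lam: "lam \<in> box_partitions m n"
          show "w mu * alternant n ?g' (exps n lam) (T mu) = w mu * alternant n (g t) (exps n lam) (T mu) +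
              (\<Sum>\<beta>\<in>box_partitions m n. C' lam \<beta> * (w mu * alternant n (g t) (exps n \<beta>) (T mu)))"
            unfolding C(2)[OF lam] distrib_left sum_distrib_left
            by (simp add: C'_def lam mult.left_commute)
        next
          fix lam \<beta> assume "C' lam \<beta> \<noteq> 0"
          then show "a \<in> exps n lam ` {..<n} \<and> a \<notin> exps n \<beta> ` {..<n}"
            using C(1)[of lam \<beta>] by (metis C'_def)
        qed
      qed
      finally show ?thesis .
    qed
    then show ?case using Suc by simp
  qed
  have "?D q = ?D (g (Suc (Max (r ` {..<m + n}))))"
    by (rule cong) (auto simp: g_def less_Suc_eq_le)
  also have "\<dots> = ?D p" by (rule replaced)
  finally show ?thesis .
qed

subsection \<open>Recursion for the index sets and the tuples\<close>

lemma ordered_listI: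
  assumes "sorted_wrt precedes xs" "\<forall>x\<in>set xs. length x = n"
  shows "ordered_list (set xs) = xs"
  using ordered_list[of "set xs" n] sorted_wrt_precedes_unique assms by (metis List.finite_set)

lemma precedes_Cons:
  "precedes (a # x) (b # y) \<longleftrightarrow> b < a \<or> a = b \<and> precedes x y"
proof
  assume "precedes (a # x) (b # y)"
  then obtain k where "k < Suc (length y)" "\<forall>i<k. (a # x) ! i = (b # y) ! i" "(a # x) ! k > (b # y) ! k"
    by (auto simp: precedes_def)
  then show "b < a \<or> a = b \<and> precedes x y"
    by (cases k) (auto simp: precedes_def All_less_Suc2)
next
  assume "b < a \<or> a = b \<and> precedes x y"
  then show "precedes (a # x) (b # y)"
  proof
    assume "a = b \<and> precedes x y"
    then obtain k where "k < length y" "\<forall>i<k. x ! i = y ! i" "x ! k > y ! k" "a = b"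
      by (auto simp: precedes_def)
    then show ?thesis
      unfolding precedes_def by (intro exI[of _ "Suc k"]) (auto simp: All_less_Suc2)
  qed (auto simp: precedes_def intro!: exI[of _ 0])
qed

lemma box_lengths: "\<forall>x\<in>box_partitions m n. length x = n"
  by (auto simp: box_partitions_def)

lemma Z_lengths: "\<forall>x\<in>Z s n. length x = s"
  by (auto simp: Z_def)

lemma box_partitions_0: "box_partitions 0 n = {replicate n 0}"
  by (auto simp: box_partitions_def sorted_wrt_iff_nth_less intro: replicate_eqI)

lemma box_partitions_Nil: "box_partitions m 0 = {[]}"
  by (auto simp: box_partitions_def)

lemma box_partitions_rec:
  "box_partitions (Suc m) (Suc n) = (#) (Suc m) ` box_partitions (Suc m) n \<union> box_partitions m (Suc n)"
proof -
  have "x \<in> (#) (Suc m) ` box_partitions (Suc m) n \<union> box_partitions m (Suc n)"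
    if "x \<in> box_partitions (Suc m) (Suc n)" for x
  proof (cases x)
    case (Cons a y)
    show ?thesis
    proof (cases "a = Suc m")
      case True
      then show ?thesis using that Cons by (auto simp: box_partitions_def)
    next
      case False
      then have "a \<le> m" using that Cons by (auto simp: box_partitions_def)
      then show ?thesis using that Cons by (fastforce simp: box_partitions_def)
    qed
  qed (use that in \<open>auto simp: box_partitions_def\<close>)
  then show ?thesis by (auto simp: box_partitions_def)
qed

fun inc_hd :: "nat list \<Rightarrow> nat list" where
  "inc_hd [] = []"
| "inc_hd (a # x) = Suc a # x"

lemma Z_1: "Z (Suc 0) n = {[n]}"
  by (auto simp: Z_def length_Suc_conv)

lemma Z_0: "Z s 0 = {replicate s 0}"
  by (auto simp: Z_def intro: replicate_eqI)

lemma Z_rec: "Z (Suc (Suc s)) (Suc n) = inc_hd ` Z (Suc (Suc s)) n \<union> (#) 0 ` Z (Suc s) (Suc n)"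
proof -
  have "x \<in> inc_hd ` Z (Suc (Suc s)) n \<union> (#) 0 ` Z (Suc s) (Suc n)"
    if x: "x \<in> Z (Suc (Suc s)) (Suc n)" for x
  proof (cases x)
    case (Cons a y)
    show ?thesis
    proof (cases a)
      case 0
      then show ?thesis using x Cons by (auto simp: Z_def)
    next
      case (Suc b)
      then have "x = inc_hd (b # y)" "b # y \<in> Z (Suc (Suc s)) n"
        using x Cons by (auto simp: Z_def)
      then show ?thesis by blast
    qed
  qed (use x in \<open>auto simp: Z_def\<close>)
  moreover have "inc_hd x \<in> Z (Suc (Suc s)) (Suc n)" if "x \<in> Z (Suc (Suc s)) n" for x
    using that by (cases x) (auto simp: Z_def)
  moreover have "0 # x \<in> Z (Suc (Suc s)) (Suc n)" if "x \<in> Z (Suc s) (Suc n)" for x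
    using that by (auto simp: Z_def)
  ultimately show ?thesis by blast
qed

lemma precedes_inc_hd: "length x = length y \<Longrightarrow> precedes (inc_hd x) (inc_hd y) = precedes x y"
  by (cases x; cases y) (auto simp: precedes_Cons)

text \<open>Partitions with maximal first part come first, just as the members of \<open>Z\<close>
  with positive first entry do in \<open>ordered_list_Z_rec\<close>. The two concatenations cut the
  big matrix into blocks whose diagonal blocks are square.\<close>

lemma ordered_list_box_rec:
  "ordered_list (box_partitions (Suc m) (Suc n)) =
    map ((#) (Suc m)) (ordered_list (box_partitions (Suc m) n)) @ ordered_list (box_partitions m (Suc n))"
proof -
  let ?xs = "map ((#) (Suc m)) (ordered_list (box_partitions (Suc m) n)) @ ordered_list (box_partitions m (Suc n))"
  note o1 = ordered_list[OF finite_box_partitions box_lengths, of "Suc m" n]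
  note o2 = ordered_list[OF finite_box_partitions box_lengths, of m "Suc n"]
  have set: "set ?xs = box_partitions (Suc m) (Suc n)"
    using o1 o2 by (auto simp: box_partitions_rec)
  have "precedes (Suc m # x) y" if "y \<in> box_partitions m (Suc n)" for x y
    using that by (cases y) (auto simp: precedes_Cons box_partitions_def)
  then have "sorted_wrt precedes ?xs"
    using o1 o2 by (auto simp: sorted_wrt_append sorted_wrt_map precedes_Cons)
  then have "ordered_list (set ?xs) = ?xs"
    by (rule ordered_listI) (unfold set, rule box_lengths)
  then show ?thesis unfolding set .
qed

lemma ordered_list_Z_rec:
  "ordered_list (Z (Suc (Suc s)) (Suc n)) =
    map inc_hd (ordered_list (Z (Suc (Suc s)) n)) @ map ((#) 0) (ordered_list (Z (Suc s) (Suc n)))"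
proof -
  let ?xs = "map inc_hd (ordered_list (Z (Suc (Suc s)) n)) @ map ((#) 0) (ordered_list (Z (Suc s) (Suc n)))"
  note o1 = ordered_list[OF finite_Z Z_lengths, of "Suc (Suc s)" n]
  note o2 = ordered_list[OF finite_Z Z_lengths, of "Suc s" "Suc n"]
  have set: "set ?xs = Z (Suc (Suc s)) (Suc n)"
    using o1 o2 by (auto simp: Z_rec)
  have "precedes (inc_hd x) (0 # y)" if "x \<in> Z (Suc (Suc s)) n" for x y
    using that by (cases x) (auto simp: precedes_Cons Z_def)
  moreover have "sorted_wrt precedes (map inc_hd (ordered_list (Z (Suc (Suc s)) n)))"
    unfolding sorted_wrt_map
    by (rule sorted_wrt_mono_rel[OF _ conjunct1[OF o1]])
       (use o1 in \<open>auto simp: precedes_inc_hd Z_def\<close>)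
  ultimately have "sorted_wrt precedes ?xs"
    using o1 o2 by (auto simp: sorted_wrt_append sorted_wrt_map[of precedes "(#) 0"] precedes_Cons)
  then have "ordered_list (set ?xs) = ?xs"
    by (rule ordered_listI) (unfold set, rule Z_lengths)
  then show ?thesis unfolding set .
qed

lemma card_box_partitions: "card (box_partitions m n) = (m + n) choose n"
proof (induction "m + n" arbitrary: m n)
  case 0
  then show ?case by (simp add: box_partitions_0)
next
  case (Suc t)
  show ?case
  proof (cases "m = 0 \<or> n = 0")
    case True
    then show ?thesis by (auto simp: box_partitions_0 box_partitions_Nil)
  next
    case False
    then obtain m' n' where mn: "m = Suc m'" "n = Suc n'" by (metis not0_implies_Suc)
    have "card (box_partitions m n) = card (box_partitions m n') + card (box_partitions m' n)"
      using distinct_ordered_list(3)[OF finite_box_partitions box_lengths] ordered_list_box_rec[of m' n']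
      unfolding mn by (metis length_append length_map)
    also have "\<dots> = ((m + n') choose n') + ((m' + n) choose n)"
      using Suc mn by simp
    also have "\<dots> = (m + n) choose n"
      by (simp add: mn)
    finally show ?thesis .
  qed
qed

lemma card_Z: "card (Z (Suc r) n) = (r + n) choose n"
  using card_length_sum_list[of "Suc r" n] by (simp add: Z_def add.commute)

lemma card_box_eq_card_Z: "card (box_partitions r n) = card (Z (Suc r) n)"
  by (simp add: card_box_partitions card_Z)

text \<open>Both sides equal \<open>Suc (r + n) * ((r + n) choose n)\<close>. This balances the
  powers of \<open>a\<close> in the two diagonal blocks of the recursion.\<close>

lemma mult_card_Z: "Suc r * card (Z (Suc (Suc r)) n) = Suc n * card (Z (Suc r) (Suc n))"
proof -
  have "Suc n * ((r + Suc n) choose Suc n) = Suc (r + n) * ((r + n) choose n)"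
    using Suc_times_binomial_eq[of "r + n" n] by (simp only: add_Suc_right mult.commute)
  moreover have "Suc r * ((Suc r + n) choose Suc r) = Suc (r + n) * ((r + n) choose r)"
    using Suc_times_binomial_eq[of "r + n" r] by (simp only: add_Suc mult.commute)
  moreover have "(Suc r + n) choose Suc r = (Suc r + n) choose n"
    using binomial_symmetric[of n "Suc r + n"] by (simp only: le_add2 add_diff_cancel_right')
  moreover have "(r + n) choose r = (r + n) choose n"
    using binomial_symmetric[of n "r + n"] by (simp only: le_add2 add_diff_cancel_right')
  ultimately show ?thesis unfolding card_Z by (simp only:)
qed

text \<open>Subtracting \<open>j\<close> from entry \<open>l\<close> is a bijection onto
  \<open>Z (Suc r) (n - j)\<close>. For \<open>j \<ge> 1\<close> this counts the tuples containing
  variable \<open>j\<close> of alphabet \<open>l + 1\<close>.\<close>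

lemma card_Z_nth_ge:
  assumes "l \<le> r" "j \<le> n"
  shows "card {mu \<in> Z (Suc r) n. j \<le> mu ! l} = (r + n - j) choose r"
proof -
  have "bij_betw (\<lambda>mu. mu[l := mu ! l + j]) (Z (Suc r) (n - j)) {mu \<in> Z (Suc r) n. j \<le> mu ! l}"
  proof (rule bij_betw_byWitness[where f' = "\<lambda>mu. mu[l := mu ! l - j]"])
    have "sum_list (mu[l := mu ! l + j]) = n" if "length mu = Suc r" "sum_list mu = n - j" for mu
      using sum_list_update[of l mu "mu ! l + j"] elem_le_sum_list[of l mu] that assms by simp
    then show "(\<lambda>mu. mu[l := mu ! l + j]) ` Z (Suc r) (n - j) \<subseteq> {mu \<in> Z (Suc r) n. j \<le> mu ! l}"
      using assms(1) by (auto simp: Z_def)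
    have "sum_list (mu[l := mu ! l - j]) = n - j"
      if "length mu = Suc r" "sum_list mu = n" "j \<le> mu ! l" for mu
      using sum_list_update[of l mu "mu ! l - j"] elem_le_sum_list[of l mu] that assms by simp
    then show "(\<lambda>mu. mu[l := mu ! l - j]) ` {mu \<in> Z (Suc r) n. j \<le> mu ! l} \<subseteq> Z (Suc r) (n - j)"
      by (auto simp: Z_def)
  qed (use assms(1) in \<open>auto simp: Z_def\<close>)
  then have "card {mu \<in> Z (Suc r) n. j \<le> mu ! l} = (r + (n - j)) choose (n - j)"
    by (simp only: bij_betw_same_card[symmetric] card_Z)
  also have "\<dots> = (r + n - j) choose r"
    using binomial_symmetric[of r "r + (n - j)"] assms by simp
  finally show ?thesis .
qed

section \<open>Decomposition of the tuples\<close>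

lemma tuple_Nil: "tuple z [] = []"
  by (simp add: tuple_def)

lemma tuple_Cons: "tuple z (a # mu) = map (z 1) [1..<Suc a] @ tuple (\<lambda>k. z (Suc k)) mu"
proof -
  have "[1..<Suc (Suc (length mu))] = 1 # [2..<Suc (Suc (length mu))]"
    by (simp add: upt_conv_Cons numeral_2_eq_2 del: upt_Suc)
  then have "tuple z (a # mu) = map (z 1) [1..<Suc a] @
      concat (map (\<lambda>k. map (z k) [1..<Suc ((a # mu) ! (k - 1))]) [2..<Suc (Suc (length mu))])"
    by (simp add: tuple_def del: upt_Suc)
  also have "[2..<Suc (Suc (length mu))] = map Suc [1..<Suc (length mu)]"
    by (simp add: map_Suc_upt numeral_2_eq_2 del: upt_Suc)
  also have "concat (map (\<lambda>k. map (z k) [1..<Suc ((a # mu) ! (k - 1))]) (map Suc [1..<Suc (length mu)])) =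
      tuple (\<lambda>k. z (Suc k)) mu"
    unfolding tuple_def map_map o_def by (intro arg_cong[where f = concat] map_cong) (auto simp: nth_Cons' simp del: upt_Suc)
  finally show ?thesis .
qed

lemma tuple_cong:
  assumes "\<And>k i. 1 \<le> k \<Longrightarrow> 1 \<le> i \<Longrightarrow> z k i = z' k i"
  shows "tuple z mu = tuple z' mu"
  unfolding tuple_def
  by (intro arg_cong[where f = concat] map_cong) (use assms in \<open>auto simp del: upt_Suc\<close>)

lemma length_tuple: "length (tuple z mu) = sum_list mu"
  by (induction mu arbitrary: z) (auto simp: tuple_Nil tuple_Cons)

lemma tuple_0_Cons: "tuple z (0 # mu) = tuple (\<lambda>k. z (Suc k)) mu"
  by (simp add: tuple_Cons)

definition drop_first :: "(nat \<Rightarrow> nat \<Rightarrow> 'a) \<Rightarrow> nat \<Rightarrow> nat \<Rightarrow> 'a" where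
  "drop_first z k i = (if k = 1 then z 1 (Suc i) else z k i)"

lemma tuple_inc_hd:
  assumes "mu \<noteq> []"
  shows "tuple z (inc_hd mu) = z 1 1 # tuple (drop_first z) mu"
proof -
  obtain a x where mu: "mu = a # x" using assms by (cases mu) auto
  have "map (z 1) [1..<Suc (Suc a)] = z 1 1 # map (z 1) (map Suc [1..<Suc a])"
    by (simp add: map_Suc_upt upt_conv_Cons del: upt_Suc)
  then have "map (z 1) [1..<Suc (Suc a)] = z 1 1 # map (drop_first z 1) [1..<Suc a]"
    by (simp add: drop_first_def o_def del: upt_Suc)
  moreover have "tuple (\<lambda>k. z (Suc k)) x = tuple (\<lambda>k. drop_first z (Suc k)) x"
    by (rule tuple_cong) (simp add: drop_first_def)
  ultimately show ?thesis
    by (simp add: mu tuple_Cons del: upt_Suc)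
qed

lemma tuple_map: "tuple (\<lambda>k i. f (z k i)) mu = map f (tuple z mu)"
  by (induction mu arbitrary: z) (auto simp: tuple_Nil tuple_Cons)

lemma set_tuple: "set (tuple z mu) \<subseteq> {z k i | k i. 1 \<le> k \<and> 1 \<le> i}"
  by (induction mu arbitrary: z) (auto simp: tuple_Nil tuple_Cons, force+)

lemma prod_list_tuple:
  fixes f :: "'a \<Rightarrow> 'b::comm_monoid_mult"
  shows "prod_list (map f (tuple z mu)) = (\<Prod>l<length mu. \<Prod>j\<in>{1..mu ! l}. f (z (Suc l) j))"
proof (induction mu arbitrary: z)
  case (Cons a mu)
  have "prod_list (map g [1..<Suc a]) = (\<Prod>j\<in>{1..a}. g j)" for g :: "nat \<Rightarrow> 'b"
    by (induction a) (auto simp: ac_simps)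
  then show ?case
    by (simp add: tuple_Cons Cons prod.lessThan_Suc_shift o_def del: upt_Suc prod.lessThan_Suc)
qed (simp add: tuple_Nil)

subsection \<open>The determinant of Schur functions\<close>

definition vandermonde :: "nat \<Rightarrow> 'a::field list \<Rightarrow> 'a" where
  "vandermonde n T = alternant n (monom 1) (exps n (replicate n 0)) T"

definition schur :: "nat \<Rightarrow> nat list \<Rightarrow> 'a::field list \<Rightarrow> 'a" where
  "schur n lam T = alternant n (monom 1) (exps n lam) T / vandermonde n T"

text \<open>The basis \<open>t^m (1 - t / a)\<close> for the degrees below \<open>N\<close>. The top
  degree \<open>N - 1\<close> is left alone, since its correction would leave the range.\<close>

definition geo :: "'a::field \<Rightarrow> nat \<Rightarrow> nat \<Rightarrow> 'a poly" where
  "geo a N m = (if Suc m < N then monom 1 m - smult (1 / a) (monom 1 (Suc m)) else monom 1 m)"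

lemma poly_geo: "Suc m < N \<Longrightarrow> poly (geo a N m) t = (1 - t / a) * t ^ m"
  by (simp add: geo_def poly_monom algebra_simps)

lemma geo_change_basis:
  assumes "b < N"
  shows "geo a N b = monom 1 b +
    (\<Sum>c\<in>{c. c < N \<and> id c > id b}. smult (if c = Suc b then - (1 / a) else 0) (monom 1 c))"
proof -
  have "(\<Sum>c\<in>{c. c < N \<and> id c > id b}. smult (if c = Suc b then - (1 / a) else 0) (monom 1 c)) =
      (\<Sum>c\<in>{c. c < N \<and> id c > id b}. if c = Suc b then smult (- (1 / a)) (monom 1 c) else 0)"
    by (intro sum.cong) auto
  also have "\<dots> = (if Suc b < N then smult (- (1 / a)) (monom 1 (Suc b)) else 0)"
    by (subst sum.delta) auto
  finally show ?thesis by (simp add: geo_def)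
qed

text \<open>The unmodified polynomial among the \<open>Suc m + n\<close> has degree
  \<open>m + n\<close>, which no degree of a partition in this box reaches. Hence
  \<open>1 - t / a\<close> can be pulled out of each row.\<close>

lemma alternant_geo:
  assumes "lam \<in> box_partitions m n" "length T = n"
  shows "alternant n (geo a (Suc m + n)) (exps n lam) T =
    prod_list (map (\<lambda>t. 1 - t / a) T) * alternant n (monom 1) (exps n lam) T"
proof -
  have "alternant n (geo a (Suc m + n)) (exps n lam) T =
      det (mat n n (\<lambda>(i, j). (1 - T ! i / a) * (T ! i) ^ exps n lam j))"
    unfolding alternant_def using exps_bound[OF assms(1)]
    by (intro arg_cong[where f = det] eq_matI) (auto simp: poly_geo)
  also have "\<dots> = (\<Prod>i<n. 1 - T ! i / a) * det (mat n n (\<lambda>(i, j). (T ! i) ^ exps n lam j))"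
    by (rule det_scale_rows)
  also have "(\<Prod>i<n. 1 - T ! i / a) = prod_list (map (\<lambda>t. 1 - t / a) T)"
    using assms(2) by (simp add: prod.list_conv_set_nth atLeast0LessThan)
  finally show ?thesis by (simp add: alternant_def poly_monom)
qed

text \<open>A first part \<open>m\<close> yields the top degree \<open>m + n\<close>, the only one
  whose polynomial does not vanish at \<open>a\<close>. The first row is therefore zero beyond its
  first entry, and the remaining minor has the degrees of \<open>lam\<close>.\<close>

lemma alternant_geo_Cons:
  assumes "lam \<in> box_partitions m n" "length T = n" "a \<noteq> 0"
  shows "alternant (Suc n) (geo a (m + Suc n)) (exps (Suc n) (m # lam)) (a # T) =
    a ^ (m + n) * prod_list (map (\<lambda>t. 1 - t / a) T) * alternant n (monom 1) (exps n lam) T"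
proof -
  let ?p = "geo a (m + Suc n)" and ?\<alpha> = "exps (Suc n) (m # lam)"
  let ?A = "mat (Suc n) (Suc n) (\<lambda>(i, j). poly (?p (?\<alpha> j)) ((a # T) ! i))"
  have e0: "?\<alpha> 0 = m + n" and eS: "?\<alpha> (Suc j) = exps n lam j" for j
    by (auto simp: exps_def)
  have row: "?A $$ (0, j) = (if j = 0 then a ^ (m + n) else 0)" if "j < Suc n" for j
  proof (cases j)
    case 0
    then show ?thesis by (simp add: e0) (simp add: geo_def poly_monom)
  next
    case (Suc k)
    then have "Suc (exps n lam k) < m + Suc n"
      using exps_bound[OF assms(1), of k] that by auto
    then show ?thesis using Suc that assms(3) by (simp add: eS poly_geo)
  qed
  have "alternant (Suc n) ?p ?\<alpha> (a # T) = (\<Sum>j<Suc n. ?A $$ (0, j) * cofactor ?A 0 j)"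
    unfolding alternant_def by (rule laplace_expansion_row) auto
  also have "\<dots> = (\<Sum>j<Suc n. if j = 0 then a ^ (m + n) * cofactor ?A 0 0 else 0)"
    by (intro sum.cong) (use row in auto)
  also have "\<dots> = a ^ (m + n) * det (mat_delete ?A 0 0)"
    by (simp add: cofactor_def)
  also have "mat_delete ?A 0 0 = mat n n (\<lambda>(i, j). poly (geo a (Suc m + n) (exps n lam j)) (T ! i))"
    unfolding mat_delete_def by (intro eq_matI) (auto simp: eS)
  also have "det \<dots> = alternant n (geo a (Suc m + n)) (exps n lam) T"
    by (simp add: alternant_def)
  also have "\<dots> = prod_list (map (\<lambda>t. 1 - t / a) T) * alternant n (monom 1) (exps n lam) T"
    by (rule alternant_geo[OF assms(1,2)])
  finally show ?thesis by (simp add: mult.assoc)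
qed

lemma det_family_mat_singleton: "det (family_mat {a} {b} f) = f a b"
proof -
  have "ordered_list (set [x]) = [x]" for x :: "nat list"
    by (rule ordered_listI[where n = "length x"]) auto
  then have "family_mat {a} {b} f = mat 1 1 (\<lambda>_. f a b)"
    unfolding family_mat_def by (intro eq_matI) auto
  then show ?thesis by (simp add: det_def)
qed

text \<open>The box with \<open>m = 0\<close> contains only the zero partition, so this is the case
  of 1 by 1 matrices; \<open>[]\<close> is a dummy column label.\<close>

lemma alternant_change_basis_0:
  fixes p q :: "nat \<Rightarrow> 'a::field poly"
  assumes "inj_on r {..<n}"
    and "\<And>a. a < n \<Longrightarrow> q a = p a + (\<Sum>b\<in>{b. b < n \<and> r b > (r a :: nat)}. smult (c a b) (p b))"
  shows "alternant n q (exps n (replicate n 0)) T = alternant n p (exps n (replicate n 0)) T"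
proof -
  have "det (family_mat (box_partitions 0 n) {[]} (\<lambda>lam mu. 1 * alternant n q (exps n lam) T)) =
      det (family_mat (box_partitions 0 n) {[]} (\<lambda>lam mu. 1 * alternant n p (exps n lam) T))"
    by (rule det_family_mat_alternant_change_basis[where k = 0 and r = r and c = c])
       (use assms in \<open>auto simp: box_partitions_0\<close>)
  then show ?thesis by (simp add: box_partitions_0 det_family_mat_singleton)
qed

text \<open>The same change of basis is applied to the denominator, so that its product of
  \<open>1 - t / a\<close> cancels against that of \<open>alternant_geo_Cons\<close>.\<close>

lemma vandermonde_Cons:
  assumes "length T = n" "a \<noteq> 0"
  shows "vandermonde (Suc n) (a # T) = a ^ n * prod_list (map (\<lambda>t. 1 - t / a) T) * vandermonde n T"
proof -
  have "vandermonde (Suc n) (a # T) = alternant (Suc n) (geo a (Suc n)) (exps (Suc n) (replicate (Suc n) 0)) (a # T)"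
    unfolding vandermonde_def
    by (rule alternant_change_basis_0[OF _ geo_change_basis, symmetric]) auto
  also have "\<dots> = a ^ n * prod_list (map (\<lambda>t. 1 - t / a) T) * vandermonde n T"
    using alternant_geo_Cons[of "replicate n 0" 0 n T a] assms
    by (simp add: box_partitions_0 vandermonde_def)
  finally show ?thesis .
qed

lemma vandermonde_nonzero:
  assumes "length T = n" "distinct T" "0 \<notin> set T"
  shows "vandermonde n T \<noteq> 0"
  using assms
proof (induction T arbitrary: n)
  case Nil
  then show ?case by (simp add: vandermonde_def alternant_def)
next
  case (Cons a T)
  then have "prod_list (map (\<lambda>t. 1 - t / a) T) \<noteq> 0"
    by (auto simp: prod_list_zero_iff)
  then show ?case using Cons by (auto simp: vandermonde_Cons)
qed

text \<open>Distinctness keeps the Vandermonde determinants nonzero; the entries must be nonzero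
  because \<open>geo\<close> divides by one of them. Only positive indices occur in tuples.\<close>

definition generic :: "(nat \<Rightarrow> nat \<Rightarrow> 'a::zero) \<Rightarrow> bool" where
  "generic z \<longleftrightarrow> (\<forall>k\<ge>1. \<forall>i\<ge>1. z k i \<noteq> 0 \<and> (\<forall>l\<ge>1. \<forall>j\<ge>1. z k i = z l j \<longrightarrow> k = l \<and> i = j))"

lemma generic_eqD:
  "generic z \<Longrightarrow> z k i = z l j \<Longrightarrow> 1 \<le> k \<Longrightarrow> 1 \<le> i \<Longrightarrow> 1 \<le> l \<Longrightarrow> 1 \<le> j \<Longrightarrow> k = l \<and> i = j"
  unfolding generic_def by blast

lemma generic_shift: "generic z \<Longrightarrow> generic (\<lambda>k. z (Suc k))"
  unfolding generic_def by (metis Suc_inject le_SucI)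

lemma generic_drop_first: "generic z \<Longrightarrow> generic (drop_first z)"
proof -
  assume z: "generic z"
  let ?g = "\<lambda>k i::nat. if k = (1::nat) then Suc i else i"
  have eq: "drop_first z k i = z k (?g k i)" for k i
    by (simp add: drop_first_def)
  have nz: "drop_first z k i \<noteq> 0" if "1 \<le> k" "1 \<le> i" for k i
    using z that unfolding eq generic_def by simp
  have "k = l \<and> i = j"
    if "1 \<le> k" "1 \<le> i" "1 \<le> l" "1 \<le> j" "drop_first z k i = drop_first z l j" for k i l j
  proof -
    have "1 \<le> ?g k i" "1 \<le> ?g l j" using that by auto
    with that z have "k = l" "?g k i = ?g l j"
      unfolding eq generic_def by blast+
    then show ?thesis by (auto split: if_splits)
  qed
  with nz show ?thesis unfolding generic_def by blast
qed

lemma generic_tuple: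
  assumes "generic z"
  shows "distinct (tuple z mu)" "0 \<notin> set (tuple z mu)"
proof -
  show "0 \<notin> set (tuple z mu)"
  proof
    assume "0 \<in> set (tuple z mu)"
    then obtain k i where "0 = z k i" "1 \<le> k" "1 \<le> i"
      using set_tuple[of z mu] by blast
    then show False using assms by (simp add: generic_def)
  qed
  show "distinct (tuple z mu)"
    using assms
  proof (induction mu arbitrary: z)
    case (Cons a mu)
    have "distinct (map (z 1) [1..<Suc a])"
      unfolding distinct_map inj_on_def using generic_eqD[OF Cons.prems, of 1 _ 1] by auto
    moreover have "set (map (z 1) [1..<Suc a]) \<inter> set (tuple (\<lambda>k. z (Suc k)) mu) = {}"
    proof -
      have False if "z 1 i = z (Suc k) j" "1 \<le> i" "1 \<le> k" "1 \<le> j" for i k j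
        using generic_eqD[OF Cons.prems that(1)] that by simp
      then show ?thesis using set_tuple[of "\<lambda>k. z (Suc k)" mu] by fastforce
    qed
    ultimately show ?case
      using Cons.IH[OF generic_shift[OF Cons.prems]] by (simp add: tuple_Cons del: upt_Suc)
  qed (simp add: tuple_Nil)
qed

lemma vandermonde_tuple: "generic z \<Longrightarrow> mu \<in> Z s n \<Longrightarrow> vandermonde n (tuple z mu) \<noteq> 0"
  using generic_tuple[of z mu] by (intro vandermonde_nonzero) (auto simp: length_tuple Z_def)

lemma det_family_mat_scale_cols:
  fixes f :: "nat list \<Rightarrow> nat list \<Rightarrow> 'a::comm_ring_1"
  assumes "finite B" "\<forall>x\<in>B. length x = k" "card A = card B"
  shows "det (family_mat A B (\<lambda>x y. c y * f x y)) = (\<Prod>y\<in>B. c y) * det (family_mat A B f)"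
proof -
  note oB = distinct_ordered_list[OF assms(1,2)]
  have "det (family_mat A B (\<lambda>x y. c y * f x y)) =
      (\<Prod>j<card B. c (ordered_list B ! j)) * det (family_mat A B f)"
    unfolding family_mat_def assms(3) by (rule det_scale_cols)
  also have "(\<Prod>j<card B. c (ordered_list B ! j)) = (\<Prod>y\<in>B. c y)"
    using prod.reindex_bij_betw[OF bij_betw_nth[OF oB(1), of "{..<card B}" B], of c] oB by auto
  finally show ?thesis .
qed

lemma family_mat_four_block:
  assumes "ordered_list A = map \<alpha> (ordered_list A1) @ ordered_list A2"
    and "ordered_list B = map \<beta> (ordered_list B1) @ map \<gamma> (ordered_list B2)"
    and card: "\<And>C. C \<in> {A, A1, A2, B, B1, B2} \<Longrightarrow> length (ordered_list C) = card C"
  shows "family_mat A B f = four_block_mat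
    (family_mat A1 B1 (\<lambda>x y. f (\<alpha> x) (\<beta> y))) (family_mat A1 B2 (\<lambda>x y. f (\<alpha> x) (\<gamma> y)))
    (family_mat A2 B1 (\<lambda>x y. f x (\<beta> y))) (family_mat A2 B2 (\<lambda>x y. f x (\<gamma> y)))"
proof -
  have "card A = card A1 + card A2" "card B = card B1 + card B2"
    using card assms(1,2) by (metis insertCI length_append length_map)+
  moreover have "length (ordered_list A1) = card A1" "length (ordered_list B1) = card B1"
    "length (ordered_list B2) = card B2"
    using card by auto
  ultimately show ?thesis
    unfolding family_mat_def by (intro eq_matI) (auto simp: assms(1,2) nth_append)
qed

definition schur_det :: "nat \<Rightarrow> nat \<Rightarrow> (nat \<Rightarrow> nat \<Rightarrow> 'a::field) \<Rightarrow> 'a" where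
  "schur_det s n z = det (family_mat (box_partitions (s - 1) n) (Z s n) (\<lambda>lam mu. schur n lam (tuple z mu)))"

lemma schur_det_1: "generic z \<Longrightarrow> schur_det 1 n z = 1"
  using vandermonde_tuple[of z "[n]" 1 n]
  by (simp add: schur_det_def box_partitions_0 Z_1 det_family_mat_singleton schur_def)
     (simp add: vandermonde_def)

lemma schur_det_0: "generic z \<Longrightarrow> schur_det s 0 z = 1"
  by (simp add: schur_det_def box_partitions_Nil Z_0 det_family_mat_singleton schur_def
      vandermonde_def alternant_def)

text \<open>
  The lower left block vanishes because an alternant at points including \<open>a = z 1 1\<close> is \<open>0\<close> unless
  it involves the last polynomial of the basis, that is, unless \<open>lam\<close> has the maximal first part.
\<close>

lemma schur_det_rec:
  assumes z: "generic z"
  shows "schur_det (Suc (Suc s)) (Suc n) z =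
    schur_det (Suc (Suc s)) n (drop_first z) * schur_det (Suc s) (Suc n) (\<lambda>k. z (Suc k)) *
    (\<Prod>mu\<in>Z (Suc s) (Suc n). prod_list (map (\<lambda>t. z 1 1 - t) (tuple (\<lambda>k. z (Suc k)) mu)))"
proof -
  define a where "a = z 1 1"
  define m where "m = Suc s"
  \<comment> \<open>The denominators act as column factors while the basis of the numerators
    changes.\<close>
  define w where "w mu = inverse (vandermonde (Suc n) (tuple z mu))" for mu
  let ?N = "m + Suc n"
  let ?f = "\<lambda>lam mu. w mu * alternant (Suc n) (geo a ?N) (exps (Suc n) lam) (tuple z mu)"
  let ?z1 = "drop_first z" and ?z2 = "\<lambda>k. z (Suc k)"
  let ?A = "family_mat (box_partitions m n) (Z (Suc m) n) (\<lambda>x y. ?f (m # x) (inc_hd y))"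
  let ?B = "family_mat (box_partitions m n) (Z m (Suc n)) (\<lambda>x y. ?f (m # x) (0 # y))"
  let ?C = "family_mat (box_partitions s (Suc n)) (Z (Suc m) n) (\<lambda>x y. ?f x (inc_hd y))"
  let ?D = "family_mat (box_partitions s (Suc n)) (Z m (Suc n)) (\<lambda>x y. ?f x (0 # y))"
  have a: "a \<noteq> 0" using z by (auto simp: generic_def a_def)
  have gen: "generic ?z1" "generic ?z2"
    using z by (auto intro: generic_shift generic_drop_first)
  have cards: "card (box_partitions m k) = card (Z (Suc m) k)"
      "card (box_partitions s k) = card (Z m k)" for k
    by (auto simp: card_box_eq_card_Z m_def)
  have head: "tuple z (inc_hd mu) = a # tuple ?z1 mu" "length (tuple ?z1 mu) = n"
    if "mu \<in> Z (Suc m) n" for mu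
  proof -
    have "mu \<noteq> []" using that by (auto simp: Z_def)
    then show "tuple z (inc_hd mu) = a # tuple ?z1 mu"
      unfolding a_def by (rule tuple_inc_hd)
    show "length (tuple ?z1 mu) = n" using that by (simp add: Z_def length_tuple)
  qed
  have tail: "tuple z (0 # mu) = tuple ?z2 mu" "length (tuple ?z2 mu) = Suc n"
    if "mu \<in> Z m (Suc n)" for mu
    using that by (auto simp: Z_def tuple_0_Cons length_tuple)
  have "schur_det (Suc m) (Suc n) z = det (family_mat (box_partitions m (Suc n)) (Z (Suc m) (Suc n))
      (\<lambda>lam mu. w mu * alternant (Suc n) (monom 1) (exps (Suc n) lam) (tuple z mu)))"
    by (simp add: schur_det_def schur_def w_def divide_inverse mult.commute)
  also have "\<dots> = det (family_mat (box_partitions m (Suc n)) (Z (Suc m) (Suc n)) ?f)"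
    by (rule det_family_mat_alternant_change_basis[OF finite_Z Z_lengths cards(1) _ geo_change_basis, symmetric])
       auto
  also have "family_mat (box_partitions m (Suc n)) (Z (Suc m) (Suc n)) ?f = four_block_mat ?A ?B ?C ?D"
    by (rule family_mat_four_block)
       (auto simp: m_def ordered_list_box_rec ordered_list_Z_rec
         distinct_ordered_list(3)[OF finite_box_partitions box_lengths]
         distinct_ordered_list(3)[OF finite_Z Z_lengths]
         simp flip: ordered_list_box_rec ordered_list_Z_rec)
  also have "?C = 0\<^sub>m (card (Z m (Suc n))) (card (Z (Suc m) n))"
  proof -
    have "?f x (inc_hd y) = 0" if x: "x \<in> box_partitions s (Suc n)" and y: "y \<in> Z (Suc m) n" for x y
      using alternant_geo[OF x, of "tuple z (inc_hd y)" a] head[OF y] a by (simp add: m_def)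
    then have "?C = family_mat (box_partitions s (Suc n)) (Z (Suc m) n) (\<lambda>x y. 0)"
      by (intro family_mat_cong[OF finite_box_partitions box_lengths finite_Z Z_lengths])
    then show ?thesis by (simp add: family_mat_def cards) (intro eq_matI, auto)
  qed
  also have "det (four_block_mat ?A ?B (0\<^sub>m (card (Z m (Suc n))) (card (Z (Suc m) n))) ?D) = det ?A * det ?D"
    by (rule det_four_block_mat_lower_left_zero) (auto simp: family_mat_def cards)
  also have "?A = family_mat (box_partitions m n) (Z (Suc m) n) (\<lambda>x y. a ^ m * schur n x (tuple ?z1 y))"
  proof (rule family_mat_cong[OF finite_box_partitions box_lengths finite_Z Z_lengths])
    fix x y assume x: "x \<in> box_partitions m n" and y: "y \<in> Z (Suc m) n"
    have "vandermonde (Suc n) (tuple z (inc_hd y)) \<noteq> 0"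
      by (rule vandermonde_tuple[OF z, of _ "Suc m"]) (use y in \<open>auto simp: Z_rec m_def\<close>)
    \<comment> \<open>The numerator contributes \<open>a ^ (m + n)\<close> and the denominator
      \<open>a ^ n\<close>; the products of \<open>1 - t / a\<close> cancel.\<close>
    then show "?f (m # x) (inc_hd y) = a ^ m * schur n x (tuple ?z1 y)"
      unfolding w_def head(1)[OF y] alternant_geo_Cons[OF x head(2)[OF y] a]
        vandermonde_Cons[OF head(2)[OF y] a] schur_def
      using a by (simp add: power_add field_simps)
  qed
  also have "det \<dots> = (a ^ m) ^ card (Z (Suc m) n) * schur_det (Suc m) n ?z1"
    by (subst det_family_mat_scale_cols[OF finite_Z Z_lengths cards(1)]) (simp add: schur_det_def)
  also have "?D = family_mat (box_partitions s (Suc n)) (Z m (Suc n))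
      (\<lambda>x y. (prod_list (map (\<lambda>t. a - t) (tuple ?z2 y)) / a ^ Suc n) * schur (Suc n) x (tuple ?z2 y))"
  proof (rule family_mat_cong[OF finite_box_partitions box_lengths finite_Z Z_lengths])
    fix x y assume x: "x \<in> box_partitions s (Suc n)" and y: "y \<in> Z m (Suc n)"
    have "prod_list (map (\<lambda>t. 1 - t / a) T) = prod_list (map (\<lambda>t. a - t) T) / a ^ length T" for T
      using a by (induction T) (auto simp: field_simps)
    then show "?f x (0 # y) = (prod_list (map (\<lambda>t. a - t) (tuple ?z2 y)) / a ^ Suc n) * schur (Suc n) x (tuple ?z2 y)"
      using alternant_geo[OF x tail(2)[OF y], of a] tail[OF y]
      by (simp add: w_def schur_def m_def divide_inverse mult_ac)
  qed
  also have "det \<dots> = (\<Prod>y\<in>Z m (Suc n). prod_list (map (\<lambda>t. a - t) (tuple ?z2 y)) / a ^ Suc n) * schur_det m (Suc n) ?z2"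
    by (subst det_family_mat_scale_cols[OF finite_Z Z_lengths cards(2)]) (simp add: schur_det_def m_def)
  also have "(\<Prod>y\<in>Z m (Suc n). prod_list (map (\<lambda>t. a - t) (tuple ?z2 y)) / a ^ Suc n) =
      (\<Prod>y\<in>Z m (Suc n). prod_list (map (\<lambda>t. a - t) (tuple ?z2 y))) / (a ^ Suc n) ^ card (Z m (Suc n))"
    by (simp only: prod_dividef prod_constant)
  \<comment> \<open>The denominator left by turning \<open>1 - t / a\<close> into
    \<open>a - t\<close> in the lower right block equals the power of \<open>a\<close> from the
    upper left one.\<close>
  also have "(a ^ Suc n) ^ card (Z m (Suc n)) = (a ^ m) ^ card (Z (Suc m) n)"
    unfolding power_mult[symmetric] using mult_card_Z[of s n] by (simp only: m_def)
  finally show ?thesis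
    using a by (simp add: m_def a_def)
qed

subsection \<open>The product\<close>

definition pair_prod :: "nat \<Rightarrow> nat \<Rightarrow> (nat \<Rightarrow> nat \<Rightarrow> 'a::comm_ring_1) \<Rightarrow> 'a" where
  "pair_prod s n z = (\<Prod>k\<in>{1..s}. \<Prod>l\<in>{k<..s}. \<Prod>i\<in>{1..n}. \<Prod>j\<in>{1..n}.
    (z k i - z l j) ^ binom (int s + int n - int i - int j - 1) (s - 2))"

lemma binom_eq_0: "x < int r \<Longrightarrow> binom x r = 0"
  by (auto simp: binom_def)

text \<open>Valid for negative \<open>x\<close> as well: at \<open>x = -1\<close> the right side is
  \<open>0\<close> because its lower index is positive.\<close>

lemma binom_pascal: "binom x (Suc r) + binom x r = binom (x + 1) (Suc r)"
proof (cases "x \<ge> 0")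
  case True
  then show ?thesis by (simp add: binom_def nat_add_distrib)
next
  case False
  then show ?thesis by (cases "x = - 1") (auto simp: binom_def)
qed

lemma prod_shift_Suc:
  fixes f :: "nat \<Rightarrow> 'a::comm_monoid_mult"
  shows "prod f {1..Suc n} = f 1 * (\<Prod>i\<in>{1..n}. f (Suc i))"
    and "prod f {Suc k<..Suc n} = (\<Prod>i\<in>{k<..n}. f (Suc i))"
    and "prod f {1<..Suc n} = (\<Prod>i\<in>{1..n}. f (Suc i))"
proof -
  show "prod f {1..Suc n} = f 1 * (\<Prod>i\<in>{1..n}. f (Suc i))"
    by (simp add: prod.atLeast_Suc_atMost prod.shift_bounds_cl_Suc_ivl del: prod.cl_ivl_Suc)
  have im: "Suc ` {k<..n} = {Suc k<..Suc n}" for k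
    by (auto simp: image_iff gr0_conv_Suc Suc_less_eq2)
  then show *: "prod f {Suc k<..Suc n} = (\<Prod>i\<in>{k<..n}. f (Suc i))" for k
    by (simp flip: im add: prod.reindex)
  have "{0<..n} = {1..n}" by auto
  then show "prod f {1<..Suc n} = (\<Prod>i\<in>{1..n}. f (Suc i))"
    using *[of 0] by simp
qed

lemma pair_prod_1: "pair_prod 1 n z = 1"
  by (simp add: pair_prod_def)

lemma pair_prod_0: "pair_prod s 0 z = 1"
  by (simp add: pair_prod_def)

lemma pair_prod_split:
  "pair_prod (Suc m) n z =
    (\<Prod>l\<in>{1..m}. \<Prod>i\<in>{1..n}. \<Prod>j\<in>{1..n}.
      (z 1 i - z (Suc l) j) ^ binom (int m + int n - int i - int j) (m - 1)) *
    (\<Prod>k\<in>{1..m}. \<Prod>l\<in>{k<..m}. \<Prod>i\<in>{1..n}. \<Prod>j\<in>{1..n}.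
      (z (Suc k) i - z (Suc l) j) ^ binom (int m + int n - int i - int j) (m - 1))"
proof -
  have "int (Suc m) + int n - int i - int j - 1 = int m + int n - int i - int j" for i j
    by simp
  moreover have "Suc m - 2 = m - 1" by simp
  ultimately show ?thesis
    unfolding pair_prod_def prod_shift_Suc by (simp only:)
qed

text \<open>For \<open>k = 1\<close>, passing from \<open>(i + 1, n + 1)\<close> to
  \<open>(i, n)\<close> preserves the exponent, so only the factors with \<open>i = 1\<close> remain
  as the extra product. For \<open>k > 1\<close>, Pascal's rule distributes the exponent over the
  two smaller cases.\<close>

lemma pair_prod_rec:
  "pair_prod (Suc (Suc s)) (Suc n) z =
    pair_prod (Suc (Suc s)) n (drop_first z) * pair_prod (Suc s) (Suc n) (\<lambda>k. z (Suc k)) *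
    (\<Prod>l\<in>{1..Suc s}. \<Prod>j\<in>{1..Suc n}. (z 1 1 - z (Suc l) j) ^ ((s + Suc n - j) choose s))"
proof -
  let ?b = "\<lambda>n i j. binom (int (Suc s) + int n - int i - int j) s"
  let ?d = "\<lambda>i j. binom (int (Suc s) + int (Suc n) - int i - int j - 1) (Suc s - 2)"
  \<comment> \<open>Here the upper entry is \<open>s - i < s\<close>; index ranges can thus be
    extended from \<open>n\<close> to \<open>n + 1\<close> without changing a product.\<close>
  have b0: "?b n i (Suc n) = 0" "?b n (Suc n) i = 0" if "1 \<le> i" for i
    using that by (auto intro!: binom_eq_0)
  have bshift: "?b (Suc n) (Suc i) j = ?b n i j" for i j
    by (intro arg_cong2[where f = binom]) auto
  have b1: "?b (Suc n) 1 j = (s + Suc n - j) choose s" if "j \<le> Suc n" for j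
    using that by (auto simp: binom_def nat_diff_distrib' of_nat_diff
        intro!: arg_cong2[where f = "(choose)"])
  have first: "(\<Prod>i\<in>{1..Suc n}. \<Prod>j\<in>{1..Suc n}. c i j ^ ?b (Suc n) i j) =
      (\<Prod>j\<in>{1..Suc n}. c 1 j ^ ((s + Suc n - j) choose s)) *
      (\<Prod>i\<in>{1..n}. \<Prod>j\<in>{1..n}. c (Suc i) j ^ ?b n i j)" for c :: "nat \<Rightarrow> nat \<Rightarrow> 'a"
  proof -
    have "(\<Prod>j\<in>{1..Suc n}. c (Suc i) j ^ ?b (Suc n) (Suc i) j) = (\<Prod>j\<in>{1..n}. c (Suc i) j ^ ?b n i j)"
      if "i \<in> {1..n}" for i
      using that b0(1)[of i] unfolding bshift by simp
    moreover have "(\<Prod>j\<in>{1..Suc n}. c 1 j ^ ?b (Suc n) 1 j) =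
        (\<Prod>j\<in>{1..Suc n}. c 1 j ^ ((s + Suc n - j) choose s))"
      by (intro prod.cong refl arg_cong2[where f = "(^)"] b1) auto
    ultimately show ?thesis
      unfolding prod_shift_Suc(1)[of "\<lambda>i. \<Prod>j\<in>{1..Suc n}. c i j ^ ?b (Suc n) i j"]
      by (simp only: cong: prod.cong)
  qed
  \<comment> \<open>Pascal's rule needs a positive lower index. For \<open>s = 0\<close> only one
    alphabet follows the first, so there is no pair with \<open>k > 1\<close> to treat.\<close>
  have second: "(\<Prod>i\<in>{1..Suc n}. \<Prod>j\<in>{1..Suc n}. c i j ^ ?b (Suc n) i j) =
      (\<Prod>i\<in>{1..n}. \<Prod>j\<in>{1..n}. c i j ^ ?b n i j) *
      (\<Prod>i\<in>{1..Suc n}. \<Prod>j\<in>{1..Suc n}. c i j ^ ?d i j)" if s: "s \<noteq> 0" for c :: "nat \<Rightarrow> nat \<Rightarrow> 'a"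
  proof -
    obtain r where r: "s = Suc r" using s by (cases s) auto
    have "?b (Suc n) i j = ?b n i j + ?d i j" for i j
      using binom_pascal[of "int (Suc s) + int n - int i - int j" r] by (simp add: r algebra_simps)
    moreover have "(\<Prod>i\<in>{1..Suc n}. \<Prod>j\<in>{1..Suc n}. c i j ^ ?b n i j) =
        (\<Prod>i\<in>{1..n}. \<Prod>j\<in>{1..n}. c i j ^ ?b n i j)"
    proof -
      have "(\<Prod>j\<in>{1..Suc n}. c (Suc n) j ^ ?b n (Suc n) j) = 1"
        using b0(2) by (intro prod.neutral) auto
      moreover have "(\<Prod>j\<in>{1..Suc n}. c i j ^ ?b n i j) = (\<Prod>j\<in>{1..n}. c i j ^ ?b n i j)"
        if "i \<in> {1..n}" for i
        using that b0(1)[of i] by simp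
      ultimately show ?thesis
        by (simp only: prod.nat_ivl_Suc' prod.cl_ivl_Suc) simp
    qed
    ultimately show ?thesis
      by (simp add: power_add prod.distrib del: prod.cl_ivl_Suc)
  qed
  have "pair_prod (Suc s) (Suc n) (\<lambda>k. z (Suc k)) =
      (\<Prod>k\<in>{1..Suc s}. \<Prod>l\<in>{k<..Suc s}. \<Prod>i\<in>{1..Suc n}. \<Prod>j\<in>{1..Suc n}.
        (z (Suc k) i - z (Suc l) j) ^ ?d i j)"
    unfolding pair_prod_def ..
  moreover have "pair_prod (Suc (Suc s)) n (drop_first z) =
      (\<Prod>l\<in>{1..Suc s}. \<Prod>i\<in>{1..n}. \<Prod>j\<in>{1..n}. (z 1 (Suc i) - z (Suc l) j) ^ ?b n i j) *
      (\<Prod>k\<in>{1..Suc s}. \<Prod>l\<in>{k<..Suc s}. \<Prod>i\<in>{1..n}. \<Prod>j\<in>{1..n}.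
        (z (Suc k) i - z (Suc l) j) ^ ?b n i j)"
    unfolding pair_prod_split diff_Suc_1
    by (intro arg_cong2[where f = "(*)"] prod.cong) (auto simp: drop_first_def)
  moreover have "pair_prod (Suc (Suc s)) (Suc n) z =
      (\<Prod>l\<in>{1..Suc s}. (\<Prod>j\<in>{1..Suc n}. (z 1 1 - z (Suc l) j) ^ ((s + Suc n - j) choose s)) *
        (\<Prod>i\<in>{1..n}. \<Prod>j\<in>{1..n}. (z 1 (Suc i) - z (Suc l) j) ^ ?b n i j)) *
      (\<Prod>k\<in>{1..Suc s}. \<Prod>l\<in>{k<..Suc s}.
        (\<Prod>i\<in>{1..n}. \<Prod>j\<in>{1..n}. (z (Suc k) i - z (Suc l) j) ^ ?b n i j) *
        (\<Prod>i\<in>{1..Suc n}. \<Prod>j\<in>{1..Suc n}. (z (Suc k) i - z (Suc l) j) ^ ?d i j))"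
    unfolding pair_prod_split diff_Suc_1
    by (intro arg_cong2[where f = "(*)"] prod.cong refl first second) auto
  ultimately show ?thesis
    unfolding prod.distrib by (simp only: ac_simps)
qed

text \<open>Double counting: \<open>c j\<close> occurs once for every \<open>mu\<close> with
  \<open>j \<le> g mu\<close>.\<close>

lemma prod_power_card:
  fixes c :: "nat \<Rightarrow> 'a::comm_monoid_mult"
  assumes "finite M" "\<And>mu. mu \<in> M \<Longrightarrow> g mu \<le> n"
  shows "(\<Prod>mu\<in>M. \<Prod>j\<in>{1..g mu}. c j) = (\<Prod>j\<in>{1..n}. c j ^ card {mu \<in> M. j \<le> g mu})"
proof -
  have "(\<Prod>mu\<in>M. \<Prod>j\<in>{1..g mu}. c j) = (\<Prod>mu\<in>M. \<Prod>j\<in>{1..n}. if j \<le> g mu then c j else 1)"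
  proof (rule prod.cong[OF refl])
    fix mu assume "mu \<in> M"
    then have "{1..g mu} = {j \<in> {1..n}. j \<le> g mu}" using assms(2) by fastforce
    then show "(\<Prod>j\<in>{1..g mu}. c j) = (\<Prod>j\<in>{1..n}. if j \<le> g mu then c j else 1)"
      by (simp only: prod.inter_filter finite_atLeastAtMost)
  qed
  also have "\<dots> = (\<Prod>j\<in>{1..n}. \<Prod>mu\<in>M. if j \<le> g mu then c j else 1)"
    by (rule prod.swap)
  also have "\<dots> = (\<Prod>j\<in>{1..n}. c j ^ card {mu \<in> M. j \<le> g mu})"
    using assms(1) by (simp add: prod.inter_filter[symmetric])
  finally show ?thesis .
qed

text \<open>The factor \<open>a - z l j\<close> occurs for exactly those \<open>mu\<close> whose
  \<open>l\<close>-th entry is at least \<open>j\<close>, and \<open>card_Z_nth_ge\<close> counts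
  them.\<close>

lemma prod_Z_tuple:
  fixes z :: "nat \<Rightarrow> nat \<Rightarrow> 'a::comm_ring_1"
  shows "(\<Prod>mu\<in>Z (Suc s) n. prod_list (map (\<lambda>t. a - t) (tuple z mu))) =
    (\<Prod>l\<in>{1..Suc s}. \<Prod>j\<in>{1..n}. (a - z l j) ^ ((s + n - j) choose s))"
proof -
  have "(\<Prod>mu\<in>Z (Suc s) n. prod_list (map (\<lambda>t. a - t) (tuple z mu))) =
      (\<Prod>mu\<in>Z (Suc s) n. \<Prod>l<Suc s. \<Prod>j\<in>{1..mu ! l}. a - z (Suc l) j)"
    by (intro prod.cong refl, subst prod_list_tuple) (auto simp: Z_def)
  also have "\<dots> = (\<Prod>l<Suc s. \<Prod>mu\<in>Z (Suc s) n. \<Prod>j\<in>{1..mu ! l}. a - z (Suc l) j)"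
    by (rule prod.swap)
  also have "\<dots> = (\<Prod>l<Suc s. \<Prod>j\<in>{1..n}. (a - z (Suc l) j) ^ ((s + n - j) choose s))"
  proof (rule prod.cong[OF refl])
    fix l assume "l \<in> {..<Suc s}"
    then have l: "l \<le> s" by auto
    have "(\<Prod>mu\<in>Z (Suc s) n. \<Prod>j\<in>{1..mu ! l}. a - z (Suc l) j) =
        (\<Prod>j\<in>{1..n}. (a - z (Suc l) j) ^ card {mu \<in> Z (Suc s) n. j \<le> mu ! l})"
      by (rule prod_power_card[OF finite_Z]) (use l in \<open>auto simp: Z_def elem_le_sum_list\<close>)
    also have "\<dots> = (\<Prod>j\<in>{1..n}. (a - z (Suc l) j) ^ ((s + n - j) choose s))"
      by (intro prod.cong) (auto simp: card_Z_nth_ge[OF l])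
    finally show "(\<Prod>mu\<in>Z (Suc s) n. \<Prod>j\<in>{1..mu ! l}. a - z (Suc l) j) =
        (\<Prod>j\<in>{1..n}. (a - z (Suc l) j) ^ ((s + n - j) choose s))" .
  qed
  also have "\<dots> = (\<Prod>l\<in>{1..Suc s}. \<Prod>j\<in>{1..n}. (a - z l j) ^ ((s + n - j) choose s))"
    by (simp only: prod.atLeast1_atMost_eq One_nat_def)
  finally show ?thesis .
qed

text \<open>Both smaller cases of the recursion lower \<open>s + n\<close>, for changed alphabets;
  hence the induction on \<open>s + n\<close> with arbitrary \<open>z\<close>. It ends at
  \<open>s = 1\<close> or \<open>n = 0\<close>.\<close>

lemma schur_det_eq_pair_prod:
  assumes "generic z" "s \<ge> 1"
  shows "schur_det s n z = pair_prod s n z"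
  using assms
proof (induction "s + n" arbitrary: s n z)
  case (Suc t)
  show ?case
  proof (cases "s = 1 \<or> n = 0")
    case True
    then show ?thesis
      using Suc.prems by (auto simp: schur_det_1[unfolded One_nat_def] pair_prod_1[unfolded One_nat_def]
          schur_det_0 pair_prod_0)
  next
    case False
    then obtain r m where [simp]: "s = Suc (Suc r)" "n = Suc m"
      using Suc.prems by (metis One_nat_def Suc_le_D not0_implies_Suc)
    have "schur_det s m (drop_first z) = pair_prod s m (drop_first z)"
      by (rule Suc.hyps(1)[OF _ generic_drop_first[OF Suc.prems(1)]]) (use Suc.hyps(2) in simp_all)
    moreover have "schur_det (Suc r) n (\<lambda>k. z (Suc k)) = pair_prod (Suc r) n (\<lambda>k. z (Suc k))"
      by (rule Suc.hyps(1)[OF _ generic_shift[OF Suc.prems(1)]]) (use Suc.hyps(2) in simp_all)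
    ultimately show ?thesis
      using Suc.prems(1)
      by (simp only: \<open>s = Suc (Suc r)\<close> \<open>n = Suc m\<close> schur_det_rec pair_prod_rec prod_Z_tuple)
  qed
qed simp

subsection \<open>Characters as ratios of alternants\<close>

lemma GL_char_eq_schur: "GL_char n lam X = schur n lam X"
proof -
  have "det (V n (\<lambda>j. int (mu ! j) + \<delta> (int n - 1) j) X) = alternant n (monom 1) (exps n mu) X" for mu
    unfolding V_def alternant_def
  proof (intro arg_cong[where f = det] eq_matI)
    fix i j assume "i < dim_row (mat n n (\<lambda>(i, j). poly (monom 1 (exps n mu j)) (X ! i)))"
      "j < dim_col (mat n n (\<lambda>(i, j). poly (monom 1 (exps n mu j)) (X ! i)))"
    moreover from this have "int (mu ! j) + \<delta> (int n - 1) j = int (exps n mu j)"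
      by (simp add: exps_def \<delta>_def of_nat_diff)
    ultimately show "mat n n (\<lambda>(i, j). X ! i powi (int (mu ! j) + \<delta> (int n - 1) j)) $$ (i, j) =
        mat n n (\<lambda>(i, j). poly (monom 1 (exps n mu j)) (X ! i)) $$ (i, j)"
      by (simp add: poly_monom)
  qed auto
  note num = this
  \<comment> \<open>The denominator is the numerator of the zero partition, so one computation
    serves both; the same is done for the other characters.\<close>
  have "V n (\<delta> (int n - 1)) X = V n (\<lambda>j. int (replicate n 0 ! j) + \<delta> (int n - 1) j) X"
    unfolding V_def by (intro eq_matI) auto
  then show ?thesis
    unfolding GL_char_def schur_def vandermonde_def by (simp only: num)
qed

text \<open>
  The polynomials in \<open>x + 1 / x\<close> that express \<open>x ^ m - x ^ (- m)\<close> and its variants; the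
  parameters \<open>c\<close> and \<open>d\<close> account for the different initial values.
\<close>

fun cheb :: "'a \<Rightarrow> 'a \<Rightarrow> nat \<Rightarrow> 'a::field poly" where
  "cheb c d 0 = 1"
| "cheb c d (Suc 0) = [:c, 1:]"
| "cheb c d (Suc (Suc m)) = pCons 0 (cheb c d (Suc m)) - smult (if m = 0 then d else 1) (cheb c d m)"

lemma coeff_cheb: "coeff (cheb c d m) m = 1 \<and> (\<forall>k>m. coeff (cheb c d m) k = 0)"
  by (induction c d m rule: cheb.induct)
     (auto simp: coeff_pCons split: nat.splits)

text \<open>The corrections have lower degree, in contrast to \<open>geo\<close>, so the rank is
  reversed and the highest degrees are replaced first.\<close>

lemma cheb_change_basis:
  assumes "a < N"
  shows "cheb c d a = monom 1 a +
    (\<Sum>b\<in>{b. b < N \<and> N - b > N - a}. smult (coeff (cheb c d a) b) (monom 1 b))"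
proof (rule poly_eqI)
  fix k
  have "{b. b < N \<and> N - b > N - a} = {..<a}" using assms by auto
  then have "coeff (monom 1 a +
      (\<Sum>b\<in>{b. b < N \<and> N - b > N - a}. smult (coeff (cheb c d a) b) (monom 1 b))) k =
      (if a = k then 1 else 0) + (\<Sum>b<a. if b = k then coeff (cheb c d a) b else 0)"
    by (simp add: coeff_sum coeff_monom of_bool_def if_distrib cong: if_cong)
  also have "\<dots> = coeff (cheb c d a) k"
    using coeff_cheb[of c d a] by (cases k a rule: linorder_cases) (simp_all add: sum.delta)
  finally show "coeff (cheb c d a) k = coeff (monom 1 a +
      (\<Sum>b\<in>{b. b < N \<and> N - b > N - a}. smult (coeff (cheb c d a) b) (monom 1 b))) k" by simp
qed

text \<open>The change of basis turns each denominator into the Vandermonde determinant. The result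
  does not depend on \<open>c\<close> and \<open>d\<close>, which is why the three families of
  characters have the same determinant.\<close>

lemma det_cheb_ratio:
  "det (family_mat (box_partitions s n) (Z (Suc s) n) (\<lambda>lam mu.
      alternant n (cheb c d) (exps n lam) (tuple y mu) /
      alternant n (cheb c d) (exps n (replicate n 0)) (tuple y mu))) = schur_det (Suc s) n y"
proof -
  have "alternant n (cheb c d) (exps n (replicate n 0)) T = vandermonde n T" for T
    unfolding vandermonde_def
    by (rule alternant_change_basis_0[where r = "\<lambda>b. n - b", OF _ cheb_change_basis])
       (auto intro!: inj_onI)
  then show ?thesis
    unfolding schur_det_def schur_def divide_inverse diff_Suc_1
    by (simp only: mult.commute[of _ "inverse _"])
       (rule det_family_mat_alternant_change_basis[where r = "\<lambda>b. s + n - b",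
          OF finite_Z Z_lengths card_box_eq_card_Z _ cheb_change_basis],
        auto intro!: inj_onI)
qed

text \<open>Chebyshev polynomials of the second kind at \<open>(x + u) / 2\<close>. The recursion
  reproduces the differences of powers up to a multiple of \<open>x * u - 1\<close>.\<close>

lemma cheb_minus:
  fixes x u :: "'a::field"
  assumes xu: "x * u = 1"
  shows "(x - u) * poly (cheb 0 1 m) (x + u) = x ^ Suc m - u ^ Suc m"
proof (induction m rule: induct_nat_012)
  case 1
  show ?case by (simp add: algebra_simps)
next
  case (ge2 m)
  have "(x - u) * poly (cheb 0 1 (Suc (Suc m))) (x + u) =
      (x + u) * ((x - u) * poly (cheb 0 1 (Suc m)) (x + u)) - (x - u) * poly (cheb 0 1 m) (x + u)"
    by (simp add: algebra_simps)
  also have "\<dots> = x ^ Suc (Suc (Suc m)) - u ^ Suc (Suc (Suc m)) + (x * u - 1) * (x ^ Suc m - u ^ Suc m)"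
    unfolding ge2 by (simp add: algebra_simps)
  finally show ?case by (simp add: xu)
qed simp

text \<open>With \<open>x = r^2\<close> the quotient by \<open>r - v\<close> is
  \<open>x^m + x^(m-1) + ... + x^(-m)\<close>, which is free of square roots; its middle term 1
  explains \<open>c = 1\<close>.\<close>

lemma cheb_minus_odd:
  fixes r v :: "'a::field"
  assumes rv: "r * v = 1"
  shows "(r - v) * poly (cheb 1 1 m) (r\<^sup>2 + v\<^sup>2) = r ^ (2 * m + 1) - v ^ (2 * m + 1)"
proof (induction m rule: induct_nat_012)
  case 1
  have "(r - v) * (1 + (r\<^sup>2 + v\<^sup>2)) = r ^ 3 - v ^ 3 + (1 - r * v) * (r - v)"
    by (simp add: algebra_simps power2_eq_square power3_eq_cube)
  then show ?case by (simp add: rv eval_nat_numeral)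
next
  case (ge2 m)
  have "(r - v) * poly (cheb 1 1 (Suc (Suc m))) (r\<^sup>2 + v\<^sup>2) =
      (r\<^sup>2 + v\<^sup>2) * ((r - v) * poly (cheb 1 1 (Suc m)) (r\<^sup>2 + v\<^sup>2)) - (r - v) * poly (cheb 1 1 m) (r\<^sup>2 + v\<^sup>2)"
    by (simp add: algebra_simps)
  also have "\<dots> = r ^ (2 * Suc (Suc m) + 1) - v ^ (2 * Suc (Suc m) + 1) +
      ((r * v)\<^sup>2 - 1) * (r ^ (2 * m + 1) - v ^ (2 * m + 1))"
    unfolding ge2 by (simp add: algebra_simps power2_eq_square)
  finally show ?case by (simp add: rv)
qed simp

text \<open>The sum is monic in \<open>x + u\<close> for \<open>m > 0\<close> but equals 2 for
  \<open>m = 0\<close>. The basis starts with 1 to stay monic: the 2 is kept outside, and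
  \<open>d = 2\<close> restores it in the one recursion step that uses degree 0.\<close>

lemma cheb_plus:
  fixes x u :: "'a::field"
  assumes xu: "x * u = 1"
  shows "(if m = 0 then 2 else 1) * poly (cheb 0 2 m) (x + u) = x ^ m + u ^ m"
proof -
  have "poly (cheb 0 2 (Suc m)) (x + u) = x ^ Suc m + u ^ Suc m" for m
  proof (induction m rule: induct_nat_012)
    case 1
    have "(x + u) * (x + u) - 2 = x * x + u * u + 2 * (x * u - 1)"
      by (simp add: algebra_simps)
    then show ?case by (simp add: xu)
  next
    case (ge2 m)
    have "poly (cheb 0 2 (Suc (Suc (Suc m)))) (x + u) =
        (x + u) * poly (cheb 0 2 (Suc (Suc m))) (x + u) - poly (cheb 0 2 (Suc m)) (x + u)"
      by simp
    also have "\<dots> = x ^ Suc (Suc (Suc m)) + u ^ Suc (Suc (Suc m)) + (x * u - 1) * (x ^ Suc m + u ^ Suc m)"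
      unfolding ge2 by (simp add: algebra_simps)
    finally show ?case by (simp add: xu)
  qed simp
  then show ?thesis by (cases m) auto
qed

text \<open>The common shape of the numerators: row factors \<open>r\<close> (such as
  \<open>x - 1 / x\<close>) cancel in the character, and column factors \<open>e\<close> record the
  exceptional 2 of the even orthogonal case.\<close>

lemma det_scaled_alternant:
  assumes "length X = n"
    and "\<And>i j. i < n \<Longrightarrow> j < n \<Longrightarrow> f i j = r (X ! i) * (e j * poly (p (\<alpha> j)) (g (X ! i)))"
  shows "det (mat n n (\<lambda>(i, j). f i j)) =
    (\<Prod>i<n. r (X ! i)) * ((\<Prod>j<n. e j) * alternant n p \<alpha> (map g X))"
proof -
  have "det (mat n n (\<lambda>(i, j). f i j)) =
      det (mat n n (\<lambda>(i, j). r (X ! i) * (e j * poly (p (\<alpha> j)) (map g X ! i))))"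
    using assms by (intro arg_cong[where f = det] eq_matI) auto
  then show ?thesis
    by (simp only: det_scale_rows det_scale_cols alternant_def)
qed

lemma powi_minus_nat: "(x::'a::field) powi (- int m) = (1 / x) ^ m"
  by (simp add: power_int_minus power_inverse divide_inverse)

lemma Sp_char_eq_ratio:
  assumes "length X = n" "\<And>x. x \<in> set X \<Longrightarrow> x \<noteq> 0 \<and> x - 1 / x \<noteq> 0"
  shows "Sp_char n lam X = alternant n (cheb 0 1) (exps n lam) (map (\<lambda>x. x + 1 / x) X) /
    alternant n (cheb 0 1) (exps n (replicate n 0)) (map (\<lambda>x. x + 1 / x) X)"
proof -
  have num: "det (W_minus n (\<lambda>j. int (mu ! j) + \<delta> (int n) j) X) =
      (\<Prod>i<n. X ! i - 1 / X ! i) *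
      ((\<Prod>j<n. 1) * alternant n (cheb 0 1) (exps n mu) (map (\<lambda>x. x + 1 / x) X))" for mu
    unfolding W_minus_def
  proof (rule det_scaled_alternant[OF assms(1), where r = "\<lambda>x. x - 1 / x"])
    fix i j assume ij: "i < n" "j < n"
    then have "X ! i * (1 / X ! i) = 1" using assms by auto
    note ch = cheb_minus[OF this, of "exps n mu j"]
    \<comment> \<open>\<open>\<delta>(n)\<close> exceeds \<open>\<delta>(n - 1)\<close> by 1, which
      matches the exponent \<open>Suc m\<close> in \<open>cheb_minus\<close>.\<close>
    have "int (mu ! j) + \<delta> (int n) j = int (Suc (exps n mu j))"
      using ij by (simp add: exps_def \<delta>_def of_nat_diff)
    then show "X ! i powi (int (mu ! j) + \<delta> (int n) j) - X ! i powi (- (int (mu ! j) + \<delta> (int n) j)) =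
        (X ! i - 1 / X ! i) * (1 * poly (cheb 0 1 (exps n mu j)) (X ! i + 1 / X ! i))"
      by (simp only: ch powi_minus_nat power_int_of_nat mult_1_left)
  qed
  have "W_minus n (\<delta> (int n)) X = W_minus n (\<lambda>j. int (replicate n 0 ! j) + \<delta> (int n) j) X"
    unfolding W_minus_def by (intro eq_matI) auto
  moreover have "(\<Prod>i<n. X ! i - 1 / X ! i) \<noteq> 0"
    using assms by auto
  ultimately show ?thesis
    unfolding Sp_char_def by (simp only: num) simp
qed

lemma O_odd_char_eq_ratio:
  assumes "length R = n" "\<And>x. x \<in> set R \<Longrightarrow> x \<noteq> 0 \<and> x - 1 / x \<noteq> 0"
  shows "O_odd_char n lam R = alternant n (cheb 1 1) (exps n lam) (map (\<lambda>r. r\<^sup>2 + 1 / r\<^sup>2) R) /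
    alternant n (cheb 1 1) (exps n (replicate n 0)) (map (\<lambda>r. r\<^sup>2 + 1 / r\<^sup>2) R)"
proof -
  have num: "det (W_minus n (\<lambda>j. 2 * int (mu ! j) + (2 * \<delta> (int n) j - 1)) R) =
      (\<Prod>i<n. R ! i - 1 / R ! i) *
      ((\<Prod>j<n. 1) * alternant n (cheb 1 1) (exps n mu) (map (\<lambda>r. r\<^sup>2 + 1 / r\<^sup>2) R))" for mu
    unfolding W_minus_def
  proof (rule det_scaled_alternant[OF assms(1), where r = "\<lambda>x. x - 1 / x"])
    fix i j assume ij: "i < n" "j < n"
    then have "R ! i * (1 / R ! i) = 1" using assms by auto
    note ch = cheb_minus_odd[OF this, of "exps n mu j", unfolded power_one_over]
    \<comment> \<open>Twice a half-integer exponent is \<open>2 m + 1\<close>, where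
      \<open>m\<close> is the degree given by \<open>exps\<close>.\<close>
    have "2 * int (mu ! j) + (2 * \<delta> (int n) j - 1) = int (2 * exps n mu j + 1)"
      using ij by (simp add: exps_def \<delta>_def of_nat_diff)
    then show "R ! i powi (2 * int (mu ! j) + (2 * \<delta> (int n) j - 1)) -
        R ! i powi (- (2 * int (mu ! j) + (2 * \<delta> (int n) j - 1))) =
        (R ! i - 1 / R ! i) * (1 * poly (cheb 1 1 (exps n mu j)) ((R ! i)\<^sup>2 + 1 / (R ! i)\<^sup>2))"
      by (simp only: ch powi_minus_nat power_int_of_nat mult_1_left power_one_over)
  qed
  have "W_minus n (\<lambda>j. 2 * \<delta> (int n) j - 1) R =
      W_minus n (\<lambda>j. 2 * int (replicate n 0 ! j) + (2 * \<delta> (int n) j - 1)) R"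
    unfolding W_minus_def by (intro eq_matI) auto
  moreover have "(\<Prod>i<n. R ! i - 1 / R ! i) \<noteq> 0"
    using assms by auto
  ultimately show ?thesis
    unfolding O_odd_char_def by (simp only: num) simp
qed

text \<open>Degree 0 can occur only in the last column, exactly when the last part is 0, and there
  it doubles the numerator. The denominator always carries this 2. It cancels if the last part is 0;
  otherwise the factor 1/2 in the definition removes it.\<close>

lemma O_even_char_eq_ratio:
  fixes X :: "'a::field list"
  assumes "length X = n" "n \<ge> 1" "\<And>x. x \<in> set X \<Longrightarrow> x \<noteq> 0" "(2::'a) \<noteq> 0"
  shows "O_even_char n lam X = alternant n (cheb 0 2) (exps n lam) (map (\<lambda>x. x + 1 / x) X) /
    alternant n (cheb 0 2) (exps n (replicate n 0)) (map (\<lambda>x. x + 1 / x) X)"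
proof -
  have num: "det (W_plus n (\<lambda>j. int (mu ! j) + \<delta> (int n - 1) j) X) =
      (if mu ! (n - 1) = 0 then 2 else 1) * alternant n (cheb 0 2) (exps n mu) (map (\<lambda>x. x + 1 / x) X)" for mu
  proof -
    have "det (W_plus n (\<lambda>j. int (mu ! j) + \<delta> (int n - 1) j) X) =
        (\<Prod>i<n. 1) * ((\<Prod>j<n. if exps n mu j = 0 then 2 else 1) *
        alternant n (cheb 0 2) (exps n mu) (map (\<lambda>x. x + 1 / x) X))"
      unfolding W_plus_def
    proof (rule det_scaled_alternant[OF assms(1), where r = "\<lambda>_. 1"])
      fix i j assume ij: "i < n" "j < n"
      then have "X ! i * (1 / X ! i) = 1" using assms by auto
      note ch = cheb_plus[OF this, of "exps n mu j"]
      have "int (mu ! j) + \<delta> (int n - 1) j = int (exps n mu j)"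
        using ij by (simp add: exps_def \<delta>_def of_nat_diff)
      then show "X ! i powi (int (mu ! j) + \<delta> (int n - 1) j) + X ! i powi (- (int (mu ! j) + \<delta> (int n - 1) j)) =
          1 * ((if exps n mu j = 0 then 2 else 1) * poly (cheb 0 2 (exps n mu j)) (X ! i + 1 / X ! i))"
        by (simp only: ch powi_minus_nat power_int_of_nat mult_1_left)
    qed
    also have "(\<Prod>j<n. if exps n mu j = 0 then 2 else 1) = (if mu ! (n - 1) = 0 then 2 else 1 :: 'a)"
    proof -
      obtain k where k: "n = Suc k" using assms(2) by (cases n) auto
      have "(\<Prod>j<k. if exps n mu j = 0 then 2 else 1) = (1 :: 'a)"
        by (rule prod.neutral) (auto simp: exps_def k)
      then show ?thesis by (simp add: k) (simp add: exps_def)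
    qed
    finally show ?thesis by simp
  qed
  have "W_plus n (\<delta> (int n - 1)) X = W_plus n (\<lambda>j. int (replicate n 0 ! j) + \<delta> (int n - 1) j) X"
    unfolding W_plus_def by (intro eq_matI) auto
  then show ?thesis
    unfolding O_even_char_def using assms(2,4) by (simp only: num) auto
qed

subsection \<open>Independence of the variables\<close>

lemma Fract_eq_iff: "Fract a 1 = Fract b 1 \<longleftrightarrow> a = (b :: 'a::idom)"
  by (simp add: eq_fract)

lemma single_ne_const:
  fixes c :: "'k::field_char_0"
  assumes "m \<noteq> (0 :: (nat \<times> nat) \<Rightarrow>\<^sub>0 nat)" "c \<noteq> 0"
  shows "Poly_Mapping.single m 1 \<noteq> Poly_Mapping.single 0 c"
  using assms by (metis lookup_single_eq lookup_single_not_eq)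

lemma x_var_eq:
  "(x_var k i :: 'k::field_char_0 ratfun) =
    Fract (Poly_Mapping.single (Poly_Mapping.single (k, i) 2) 1) 1"
  by (simp add: x_var_def rt_var_def power2_eq_square mult_single single_add[symmetric] numeral_2_eq_2)

lemma x_var_inj: "(x_var k i :: 'k::field_char_0 ratfun) = x_var l j \<Longrightarrow> k = l \<and> i = j"
proof -
  assume "(x_var k i :: 'k ratfun) = x_var l j"
  then have "Poly_Mapping.single (Poly_Mapping.single (k, i) (2::nat)) (1::'k) =
      Poly_Mapping.single (Poly_Mapping.single (l, j) 2) 1"
    unfolding x_var_eq Fract_eq_iff .
  then have "Poly_Mapping.single (k, i) (2::nat) = Poly_Mapping.single (l, j) 2"
    by (metis lookup_single_eq lookup_single_not_eq zero_neq_one)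
  then have "(k, i) = (l, j)"
    by (metis lookup_single_eq lookup_single_not_eq zero_neq_numeral)
  then show ?thesis by simp
qed

text \<open>The exponent of \<open>(k, i)\<close> in the product is positive even if the two
  variables coincide. For \<open>c = 1\<close> this separates \<open>x\<close> from inverses of
  variables, making the values \<open>x + 1 / x\<close> distinct; for \<open>c = -1\<close> it shows
  that they are nonzero.\<close>

lemma x_var_mult_ne:
  fixes c :: "'k::field_char_0"
  assumes "c \<noteq> 0"
  shows "(x_var k i :: 'k ratfun) * x_var l j \<noteq> Fract (Poly_Mapping.single 0 c) 1"
proof -
  have "Poly_Mapping.lookup (Poly_Mapping.single (k, i) (2::nat) + Poly_Mapping.single (l, j) 2) (k, i) \<noteq> 0"
    by (simp add: lookup_add)
  then have "Poly_Mapping.single (k, i) (2::nat) + Poly_Mapping.single (l, j) 2 \<noteq> 0"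
    by auto
  then show ?thesis
    using single_ne_const[OF _ assms] by (simp add: x_var_eq mult_single Fract_eq_iff)
qed

lemma x_var_mult_ne_1: "(x_var k i :: 'k::field_char_0 ratfun) * x_var l j \<noteq> 1"
  using x_var_mult_ne[of "1 :: 'k" k i l j] by (simp add: One_fract_def)

lemma x_var_mult_ne_minus_1: "(x_var k i :: 'k::field_char_0 ratfun) * x_var l j \<noteq> - 1"
  using x_var_mult_ne[of "- 1 :: 'k" k i l j] by (simp add: One_fract_def single_uminus)

lemma rt_var_nonzero: "(rt_var k i :: 'k::field_char_0 ratfun) \<noteq> 0"
  using single_zero[of "Poly_Mapping.single (k, i) 1 :: (nat \<times> nat) \<Rightarrow>\<^sub>0 nat", where 'b = 'k]
  unfolding rt_var_def Zero_fract_def Fract_eq_iff by (metis lookup_single_eq zero_neq_one)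

lemma x_var_nonzero: "(x_var k i :: 'k::field_char_0 ratfun) \<noteq> 0"
  by (simp add: x_var_def rt_var_nonzero)

lemma two_ratfun_nonzero: "(2 :: 'k::field_char_0 ratfun) \<noteq> 0"
proof -
  have "(2 :: 'k ratfun) = 1 + 1" by simp
  also have "\<dots> = Fract (1 + 1) 1"
    unfolding One_fract_def by (subst add_fract) simp_all
  finally have two: "(2 :: 'k ratfun) = Fract (1 + 1) 1" .
  have "Poly_Mapping.lookup (1 + 1 :: ((nat \<times> nat) \<Rightarrow>\<^sub>0 nat) \<Rightarrow>\<^sub>0 'k) 0 \<noteq> 0"
    unfolding lookup_add lookup_one by simp
  then have "(1 + 1 :: ((nat \<times> nat) \<Rightarrow>\<^sub>0 nat) \<Rightarrow>\<^sub>0 'k) \<noteq> 0" by (metis lookup_zero)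
  then show ?thesis unfolding two by (simp add: Zero_fract_def eq_fract)
qed

lemma x_minus_inverse_nonzero: "(x_var k i :: 'k::field_char_0 ratfun) - 1 / x_var k i \<noteq> 0"
  using x_var_mult_ne_1[of k i k i, where 'k = 'k] x_var_nonzero[of k i, where 'k = 'k] by (simp add: field_simps)

lemma rt_minus_inverse_nonzero: "(rt_var k i :: 'k::field_char_0 ratfun) - 1 / rt_var k i \<noteq> 0"
proof
  assume "(rt_var k i :: 'k ratfun) - 1 / rt_var k i = 0"
  then have "(x_var k i :: 'k ratfun) = 1"
    using rt_var_nonzero[of k i, where 'k = 'k] by (simp add: x_var_def field_simps power2_eq_square)
  then show False using x_var_mult_ne_1[of k i k i, where 'k = 'k] by simp
qed

definition y_var :: "nat \<Rightarrow> nat \<Rightarrow> 'k::field_char_0 ratfun" where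
  "y_var k i = x_var k i + 1 / x_var k i"

text \<open>The difference is \<open>(x - x') * (1 - 1 / (x * x'))\<close>; clearing the inner
  denominator changes two signs, whence the reversed order of the variables in the product
  formula.\<close>

lemma y_var_diff: "(y_var k i :: 'k::field_char_0 ratfun) - y_var l j =
    (x_var l j - x_var k i) * (1 - x_var k i * x_var l j) / (x_var k i * x_var l j)"
  using x_var_nonzero[of k i, where 'k = 'k] x_var_nonzero[of l j, where 'k = 'k]
  by (simp add: y_var_def field_simps)

lemma generic_x_var: "generic (x_var :: nat \<Rightarrow> nat \<Rightarrow> 'k::field_char_0 ratfun)"
  unfolding generic_def using x_var_nonzero x_var_inj by blast

lemma generic_y_var: "generic (y_var :: nat \<Rightarrow> nat \<Rightarrow> 'k::field_char_0 ratfun)"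
proof -
  have "(y_var k i :: 'k ratfun) \<noteq> 0" for k i
  proof
    assume "(y_var k i :: 'k ratfun) = 0"
    then have "(x_var k i :: 'k ratfun) * x_var k i = - 1"
      using x_var_nonzero[of k i, where 'k = 'k]
      by (simp add: y_var_def field_simps eq_neg_iff_add_eq_0)
    then show False using x_var_mult_ne_minus_1 by blast
  qed
  moreover have "k = l \<and> i = j" if "(y_var k i :: 'k ratfun) = y_var l j" for k i l j
  proof -
    have "(x_var l j - x_var k i) * (1 - x_var k i * x_var l j :: 'k ratfun) = 0"
      using that y_var_diff[of k i l j, where 'k = 'k] x_var_nonzero[where 'k = 'k] by simp
    then have "(x_var l j :: 'k ratfun) = x_var k i"
      using x_var_mult_ne_1[of k i l j, where 'k = 'k] by simp
    then show ?thesis using x_var_inj by metis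
  qed
  ultimately show ?thesis unfolding generic_def by blast
qed

subsection \<open>The compound determinants\<close>

theorem theorem3p2:
  fixes s n :: nat
  assumes "s \<ge> 1" and "n \<ge> 1"
  shows
    "det (family_mat (box_partitions (s - 1) n) (Z s n)
        (\<lambda>lam mu. GL_char n lam (tuple (x_var :: nat \<Rightarrow> nat \<Rightarrow> 'k::field_char_0 ratfun) mu)))
     = (\<Prod>k\<in>{1..s}. \<Prod>l\<in>{k<..s}. \<Prod>i\<in>{1..n}. \<Prod>j\<in>{1..n}.
          (x_var k i - x_var l j) ^ binom (int s + int n - int i - int j - 1) (s - 2))
     \<and>
     det (family_mat (box_partitions (s - 1) n) (Z s n)
        (\<lambda>lam mu. O_odd_char n lam (tuple (rt_var :: nat \<Rightarrow> nat \<Rightarrow> 'k ratfun) mu)))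
     = det (family_mat (box_partitions (s - 1) n) (Z s n)
        (\<lambda>lam mu. Sp_char n lam (tuple (x_var :: nat \<Rightarrow> nat \<Rightarrow> 'k ratfun) mu)))
     \<and>
     det (family_mat (box_partitions (s - 1) n) (Z s n)
        (\<lambda>lam mu. Sp_char n lam (tuple (x_var :: nat \<Rightarrow> nat \<Rightarrow> 'k ratfun) mu)))
     = det (family_mat (box_partitions (s - 1) n) (Z s n)
        (\<lambda>lam mu. O_even_char n lam (tuple (x_var :: nat \<Rightarrow> nat \<Rightarrow> 'k ratfun) mu)))
     \<and>
     det (family_mat (box_partitions (s - 1) n) (Z s n)
        (\<lambda>lam mu. O_even_char n lam (tuple (x_var :: nat \<Rightarrow> nat \<Rightarrow> 'k ratfun) mu)))
     = (\<Prod>k\<in>{1..s}. \<Prod>l\<in>{k<..s}. \<Prod>i\<in>{1..n}. \<Prod>j\<in>{1..n}.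
          ((x_var l j - x_var k i) * (1 - x_var k i * x_var l j) / (x_var k i * x_var l j))
            ^ binom (int s + int n - int i - int j - 1) (s - 2))"
proof -
  let ?det = "\<lambda>f. det (family_mat (box_partitions (s - 1) n) (Z s n) f)"
  let ?ratio = "\<lambda>c d lam mu. alternant n (cheb c d) (exps n lam) (tuple y_var mu) /
      alternant n (cheb c d) (exps n (replicate n 0)) (tuple (y_var :: nat \<Rightarrow> nat \<Rightarrow> 'k ratfun) mu)"
  have s: "s = Suc (s - 1)" using assms by simp
  have ratio: "?det (?ratio c d) = schur_det s n (y_var :: nat \<Rightarrow> nat \<Rightarrow> 'k ratfun)" for c d
    using det_cheb_ratio[of "s - 1" n c d y_var] s by simp
  have yx: "tuple y_var mu = map (\<lambda>x. x + 1 / x) (tuple (x_var :: nat \<Rightarrow> nat \<Rightarrow> 'k ratfun) mu)" for mu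
    unfolding tuple_map[symmetric] y_var_def[abs_def] ..
  have yr: "tuple y_var mu = map (\<lambda>r. r\<^sup>2 + 1 / r\<^sup>2) (tuple (rt_var :: nat \<Rightarrow> nat \<Rightarrow> 'k ratfun) mu)" for mu
    unfolding tuple_map[symmetric] y_var_def[abs_def] x_var_def ..
  have x: "x \<noteq> 0 \<and> x - 1 / x \<noteq> 0"
    if mem: "x \<in> set (tuple (x_var :: nat \<Rightarrow> nat \<Rightarrow> 'k ratfun) mu)" for x mu
  proof -
    obtain k i where "x = x_var k i"
      using mem set_tuple[of "x_var :: nat \<Rightarrow> nat \<Rightarrow> 'k ratfun" mu] by blast
    then show ?thesis by (simp add: x_var_nonzero x_minus_inverse_nonzero del: right_minus_eq)
  qed
  have r: "r \<noteq> 0 \<and> r - 1 / r \<noteq> 0"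
    if mem: "r \<in> set (tuple (rt_var :: nat \<Rightarrow> nat \<Rightarrow> 'k ratfun) mu)" for r mu
  proof -
    obtain k i where "r = rt_var k i"
      using mem set_tuple[of "rt_var :: nat \<Rightarrow> nat \<Rightarrow> 'k ratfun" mu] by blast
    then show ?thesis by (simp add: rt_var_nonzero rt_minus_inverse_nonzero del: right_minus_eq)
  qed
  have len: "length (tuple z mu) = n" if "mu \<in> Z s n" for mu and z :: "nat \<Rightarrow> nat \<Rightarrow> 'k ratfun"
    using that by (simp add: length_tuple Z_def)
  note cong = arg_cong[where f = det, OF family_mat_cong[OF finite_box_partitions box_lengths finite_Z Z_lengths]]
  \<comment> \<open>The parameters \<open>(c, d)\<close> are \<open>(1, 1)\<close> here,
    \<open>(0, 1)\<close> for the symplectic and \<open>(0, 2)\<close> for the even orthogonal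
    characters.\<close>
  have odd: "?det (\<lambda>lam mu. O_odd_char n lam (tuple rt_var mu)) = schur_det s n (y_var :: nat \<Rightarrow> nat \<Rightarrow> 'k ratfun)"
    by (subst ratio[of 1 1, symmetric], rule cong, subst O_odd_char_eq_ratio)
       (use len r in \<open>auto simp: yr\<close>)
  have sp: "?det (\<lambda>lam mu. Sp_char n lam (tuple x_var mu)) = schur_det s n (y_var :: nat \<Rightarrow> nat \<Rightarrow> 'k ratfun)"
    by (subst ratio[of 0 1, symmetric], rule cong, subst Sp_char_eq_ratio)
       (use len x in \<open>auto simp: yx\<close>)
  have even: "?det (\<lambda>lam mu. O_even_char n lam (tuple x_var mu)) = schur_det s n (y_var :: nat \<Rightarrow> nat \<Rightarrow> 'k ratfun)"
    by (subst ratio[of 0 2, symmetric], rule cong, subst O_even_char_eq_ratio)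
       (use len x assms(2) two_ratfun_nonzero in \<open>auto simp: yx\<close>)
  have gl: "?det (\<lambda>lam mu. GL_char n lam (tuple x_var mu)) = schur_det s n (x_var :: nat \<Rightarrow> nat \<Rightarrow> 'k ratfun)"
    by (simp add: GL_char_eq_schur schur_det_def)
  show ?thesis
    unfolding odd sp even gl schur_det_eq_pair_prod[OF generic_x_var assms(1)]
      schur_det_eq_pair_prod[OF generic_y_var assms(1)] pair_prod_def y_var_diff
    by simp
qed

end
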